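(* Let $(X,b,m)$ be a weighted graph satisfying (C), (B), (M). Assume $D\subsetneq X$ is $d_L$-relatively dense and set $\Omega:=X\setminus D$. Let $T>0$, $\delta\in[0,1)$, $r\in[1,\infty]$. Define $\lambda$ by $2\lambda=(\operatorname{Inr}(\Omega)\operatorname{vol}(\operatorname{Inr}(\Omega)))^{-1}$, $\kappa:=8\|H+1\|^2\operatorname{Inr}(\Omega)\operatorname{vol}(\operatorname{Inr}(\Omega))$, $K:=\kappa/((1-\delta)T)^{1/r}$ and $\alpha:=(\kappa+1)e^{-\delta\lambda T}$, where all metric quantities are taken with respect to $d_L$. Then for all $\varphi_0\in\ell_2(X,m)$, \[\|S_T\varphi_0\|\le K\,\|(S_{(\cdot)}\varphi_0)|_D\|_{L_r((\delta T,T);\ell_2(D,m|_D))}+\alpha\|\varphi_0\|.\]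
   Context: A weighted graph $(X,b,m)$: $X$ countable, $m\colon X\to(0,\infty)$ (measure $m(A)=\sum_{x\in A}m(x)$), $b\colon X\times X\to[0,\infty)$ symmetric with $b(x,x)=0$ and $\sum_y b(x,y)<\infty$. Paths: $(x_0,\dots,x_k)$ with $b(x_j,x_{j+1})>0$. Assumptions: (C) connected; (B) $\sup_x\operatorname{Deg}(x)<\infty$, $\operatorname{Deg}(x)=\frac1{m(x)}\sum_yb(x,y)$; (M) $\sup_xm(x)<\infty$. Length metric: $d_L(x,y)=\inf\{\sum_{j}1/b(x_j,x_{j+1}) : (x_0,\dots,x_k)\text{ path from }x\text{ to }y\}$ for $x\neq y$. For the metric $d=d_L$: $U_r(x)=\{y:d(x,y)<r\}$, $B_r(x)=\{y:d(x,y)\le r\}$; $D$ is relatively dense if $\inf\{R>0:\bigcup_{x\in D}B_R(x)=X\}<\infty$; inradius $\operatorname{Inr}(\Omega)=\sup\{r>0:\exists x\in\Omega,\ U_r(x)\subseteq\Omega\}$; $\operatorname{vol}(r)=\sup_{x\in X}m(B_r(x))$. $H$ is the weighted Laplacian $Hf(x)=\frac1{m(x)}\sum_yb(x,y)(f(x)-f(y))$ on $\ell_2(X,m)$ (bounded, self-adjoint, non-negative), $\|H+1\|$ its operator norm, and $S_t=e^{-tH}$. *)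

theory Defs
  imports "HOL-Analysis.Analysis" "HOL-Probability.Essential_Supremum"
begin

definition weighted_graph :: "('a::countable \<Rightarrow> 'a \<Rightarrow> real) \<Rightarrow> ('a \<Rightarrow> real) \<Rightarrow> bool" where
  "weighted_graph b m \<longleftrightarrow>
     (\<forall>x. m x > 0) \<and> (\<forall>x y. b x y \<ge> 0) \<and> (\<forall>x y. b x y = b y x) \<and>
     (\<forall>x. b x x = 0) \<and> (\<forall>x. (\<lambda>y. b x y) summable_on UNIV)"

definition is_path :: "('a \<Rightarrow> 'a \<Rightarrow> real) \<Rightarrow> 'a list \<Rightarrow> 'a \<Rightarrow> 'a \<Rightarrow> bool" where
  "is_path b p x y \<longleftrightarrow> p \<noteq> [] \<and> hd p = x \<and> last p = y \<and>
     (\<forall>j < length p - 1. b (p ! j) (p ! Suc j) > 0)"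

definition connected_graph :: "('a \<Rightarrow> 'a \<Rightarrow> real) \<Rightarrow> bool" where
  "connected_graph b \<longleftrightarrow> (\<forall>x y. \<exists>p. is_path b p x y)"

definition Deg :: "('a \<Rightarrow> 'a \<Rightarrow> real) \<Rightarrow> ('a \<Rightarrow> real) \<Rightarrow> 'a \<Rightarrow> real" where
  "Deg b m x = (\<Sum>\<^sub>\<infinity>y. b x y) / m x"

definition bounded_degree :: "('a \<Rightarrow> 'a \<Rightarrow> real) \<Rightarrow> ('a \<Rightarrow> real) \<Rightarrow> bool" where
  "bounded_degree b m \<longleftrightarrow> bdd_above (range (Deg b m))"

definition bounded_measure :: "('a \<Rightarrow> real) \<Rightarrow> bool" where
  "bounded_measure m \<longleftrightarrow> bdd_above (range m)"

definition path_length :: "('a \<Rightarrow> 'a \<Rightarrow> real) \<Rightarrow> 'a list \<Rightarrow> real" where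
  "path_length b p = (\<Sum>j < length p - 1. 1 / b (p ! j) (p ! Suc j))"

definition dL :: "('a \<Rightarrow> 'a \<Rightarrow> real) \<Rightarrow> 'a \<Rightarrow> 'a \<Rightarrow> real" where
  "dL b x y = (if x = y then 0 else Inf {path_length b p | p. is_path b p x y})"

definition open_ball :: "('a \<Rightarrow> 'a \<Rightarrow> real) \<Rightarrow> real \<Rightarrow> 'a \<Rightarrow> 'a set" where
  "open_ball d r x = {y. d x y < r}"

definition closed_ball :: "('a \<Rightarrow> 'a \<Rightarrow> real) \<Rightarrow> real \<Rightarrow> 'a \<Rightarrow> 'a set" where
  "closed_ball d r x = {y. d x y \<le> r}"

(* relatively dense: inf{R>0 : \<Union>_{x\<in>D} B_R(x) = X} < \<infinity>, i.e. the set is nonempty *)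
definition rel_dense :: "('a \<Rightarrow> 'a \<Rightarrow> real) \<Rightarrow> 'a set \<Rightarrow> bool" where
  "rel_dense d D \<longleftrightarrow> (\<exists>R>0. (\<Union>x\<in>D. closed_ball d R x) = UNIV)"

definition inradius :: "('a \<Rightarrow> 'a \<Rightarrow> real) \<Rightarrow> 'a set \<Rightarrow> real" where
  "inradius d \<Omega> = Sup {r. r > 0 \<and> (\<exists>x\<in>\<Omega>. open_ball d r x \<subseteq> \<Omega>)}"

definition meas :: "('a \<Rightarrow> real) \<Rightarrow> 'a set \<Rightarrow> real" where
  "meas m A = (\<Sum>\<^sub>\<infinity>x\<in>A. m x)"

definition vol :: "('a \<Rightarrow> 'a \<Rightarrow> real) \<Rightarrow> ('a \<Rightarrow> real) \<Rightarrow> real \<Rightarrow> real" where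
  "vol d m r = (SUP x. meas m (closed_ball d r x))"

definition in_l2 :: "('a \<Rightarrow> real) \<Rightarrow> ('a \<Rightarrow> complex) \<Rightarrow> bool" where
  "in_l2 m f \<longleftrightarrow> (\<lambda>x. (cmod (f x))\<^sup>2 * m x) summable_on UNIV"

definition l2norm_on :: "('a \<Rightarrow> real) \<Rightarrow> 'a set \<Rightarrow> ('a \<Rightarrow> complex) \<Rightarrow> real" where
  "l2norm_on m A f = sqrt (\<Sum>\<^sub>\<infinity>x\<in>A. (cmod (f x))\<^sup>2 * m x)"

definition l2norm :: "('a \<Rightarrow> real) \<Rightarrow> ('a \<Rightarrow> complex) \<Rightarrow> real" where
  "l2norm m f = l2norm_on m UNIV f"

definition Lap :: "('a \<Rightarrow> 'a \<Rightarrow> real) \<Rightarrow> ('a \<Rightarrow> real) \<Rightarrow> ('a \<Rightarrow> complex) \<Rightarrow> 'a \<Rightarrow> complex" where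
  "Lap b m f x = (\<Sum>\<^sub>\<infinity>y. complex_of_real (b x y) * (f x - f y)) / complex_of_real (m x)"

definition opnorm_H1 :: "('a \<Rightarrow> 'a \<Rightarrow> real) \<Rightarrow> ('a \<Rightarrow> real) \<Rightarrow> real" where
  "opnorm_H1 b m = Sup {l2norm m (\<lambda>x. Lap b m f x + f x) | f. in_l2 m f \<and> l2norm m f \<le> 1}"

(* heat semigroup S_t = e^{-tH} = \<Sum>_n (-t)^n H^n / n! (H bounded; the series converges in
   \<ell>_2 and hence pointwise) *)
definition heat :: "('a \<Rightarrow> 'a \<Rightarrow> real) \<Rightarrow> ('a \<Rightarrow> real) \<Rightarrow> real \<Rightarrow> ('a \<Rightarrow> complex) \<Rightarrow> 'a \<Rightarrow> complex" where
  "heat b m t f x = (\<Sum>n. complex_of_real ((- t) ^ n / fact n) * ((Lap b m ^^ n) f x))"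

definition Lr_norm :: "ereal \<Rightarrow> real \<Rightarrow> real \<Rightarrow> (real \<Rightarrow> real) \<Rightarrow> real" where
  "Lr_norm r a c g =
     (if r = \<infinity> then real_of_ereal (esssup (restrict_space lborel {a<..<c}) (\<lambda>t. ereal \<bar>g t\<bar>))
      else (set_lebesgue_integral lborel {a<..<c} (\<lambda>t. \<bar>g t\<bar> powr real_of_ereal r))
             powr (1 / real_of_ereal r))"

end

theory Submission
  imports Defs
begin

text \<open>
  Nearest-point paths to \<open>D\<close> have length at most \<open>\<rho> = Inr(\<Omega>)\<close>, and a path through a vertex \<open>u\<close> starts in
  \<open>B\<^sub>\<rho>(u)\<close>. Cauchy-Schwarz along these paths, followed by counting paths through each edge, gives the
  Poincare inequality \<open>\<parallel>f\<parallel>\<^sup>2 \<le> \<rho> vol(\<rho>) \<langle>H f, f\<rangle>\<close> for \<open>f\<close> vanishing on \<open>D\<close>. Hence functions of low energy,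
  \<open>\<langle>H f, f\<rangle> \<le> lam \<parallel>f\<parallel>\<^sup>2\<close>, satisfy \<open>\<parallel>f\<parallel> \<le> \<kappa> \<parallel>f|\<^sub>D\<parallel>\<close>.

  No spectral projections are needed to combine this with the heat flow. Since \<open>\<parallel>exp(lam s) S\<^sub>s \<phi>\<parallel>\<^sup>2\<close> is convex
  in \<open>s\<close>, at each time \<open>t\<close> either \<open>S\<^sub>t \<phi>\<close> has low energy or \<open>\<parallel>S\<^sub>t \<phi>\<parallel> \<le> exp(-lam t) \<parallel>\<phi>\<parallel>\<close>. So
  \<open>\<parallel>S\<^sub>T \<phi>\<parallel> \<le> \<parallel>S\<^sub>t \<phi>\<parallel> \<le> \<kappa> \<parallel>(S\<^sub>t \<phi>)|\<^sub>D\<parallel> + exp(-lam t) \<parallel>\<phi>\<parallel>\<close> for \<open>0 \<le> t \<le> T\<close>, and taking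
  \<open>L\<^sub>r\<close>-norms over \<open>(\<delta>T, T)\<close> finishes the proof.
\<close>

section \<open>The weighted space of square-summable functions\<close>

locale weighted_space =
  fixes m :: "'a::countable \<Rightarrow> real"
  assumes m_pos: "m x > 0"
begin

text \<open>The product \<open>\<bullet>\<close> on \<open>complex\<close> is that of the real
  plane, so this is the real part of the Hermitian product. All forms used below are
  real-valued.\<close>

definition ip :: "('a \<Rightarrow> complex) \<Rightarrow> ('a \<Rightarrow> complex) \<Rightarrow> real" where
  "ip f g = (\<Sum>\<^sub>\<infinity>x. m x * (f x \<bullet> g x))"

lemma m_nonneg: "m x \<ge> 0"
  using m_pos[of x] by simp

lemma in_l2_iff: "in_l2 m f \<longleftrightarrow> (\<lambda>x. m x * (f x \<bullet> f x)) summable_on UNIV"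
  by (simp add: in_l2_def power2_norm_eq_inner mult.commute)

lemma ip_self_nonneg: "ip f f \<ge> 0"
  unfolding ip_def by (rule infsum_nonneg) (simp add: m_nonneg)

lemma l2norm_power2: "(l2norm m f)\<^sup>2 = ip f f"
proof -
  have "ip f f = (\<Sum>\<^sub>\<infinity>x. (cmod (f x))\<^sup>2 * m x)"
    unfolding ip_def by (simp add: power2_norm_eq_inner mult.commute)
  then show ?thesis
    using ip_self_nonneg[of f] by (simp add: l2norm_def l2norm_on_def)
qed

lemma l2norm_nonneg: "l2norm m f \<ge> 0"
  unfolding l2norm_def l2norm_on_def
  by (intro real_sqrt_ge_zero infsum_nonneg) (simp add: m_nonneg)

lemma l2norm_eq_sqrt_ip: "l2norm m f = sqrt (ip f f)"
  by (metis l2norm_nonneg l2norm_power2 real_sqrt_unique)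

lemma ip_summable:
  assumes "in_l2 m f" "in_l2 m g"
  shows "(\<lambda>x. m x * (f x \<bullet> g x)) summable_on UNIV"
proof -
  have "(\<lambda>x. norm (m x * (f x \<bullet> g x))) summable_on UNIV"
  proof (rule summable_on_comparison_test)
    show "(\<lambda>x. m x * (f x \<bullet> f x) + m x * (g x \<bullet> g x)) summable_on UNIV"
      using assms by (intro summable_on_add) (simp_all add: in_l2_iff)
  next
    fix x
    have "\<bar>f x \<bullet> g x\<bar> \<le> norm (f x) * norm (g x)"
      by (rule Cauchy_Schwarz_ineq2)
    also have "\<dots> \<le> f x \<bullet> f x + g x \<bullet> g x"
      using sum_squares_bound[of "norm (f x)" "norm (g x)"]
        mult_nonneg_nonneg[OF norm_ge_zero[of "f x"] norm_ge_zero[of "g x"]]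
      unfolding power2_norm_eq_inner[symmetric] by linarith
    finally show "norm (m x * (f x \<bullet> g x)) \<le> m x * (f x \<bullet> f x) + m x * (g x \<bullet> g x)"
      using m_nonneg[of x] by (simp add: abs_mult mult_left_mono flip: distrib_left)
  qed auto
  then show ?thesis
    by (rule abs_summable_summable)
qed

lemma ip_commute: "ip f g = ip g f"
  by (simp add: ip_def inner_commute)

lemma in_l2_scaleR: "in_l2 m f \<Longrightarrow> in_l2 m (\<lambda>x. c *\<^sub>R f x)"
  using summable_on_cmult_right[of "\<lambda>x. m x * (f x \<bullet> f x)" UNIV "c * c"]
  by (simp add: in_l2_iff mult_ac)

lemma in_l2_add:
  assumes "in_l2 m f" "in_l2 m g"
  shows "in_l2 m (\<lambda>x. f x + g x)"
proof -
  have "(\<lambda>x. m x * (f x \<bullet> f x) + m x * (g x \<bullet> g x) + 2 * (m x * (f x \<bullet> g x))) summable_on UNIV"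
    using assms ip_summable[OF assms]
    by (intro summable_on_add summable_on_cmult_right) (simp_all add: in_l2_iff)
  moreover have "m x * (f x \<bullet> f x) + m x * (g x \<bullet> g x) + 2 * (m x * (f x \<bullet> g x))
      = m x * ((f x + g x) \<bullet> (f x + g x))" for x
    by (simp add: inner_add inner_commute algebra_simps)
  ultimately show ?thesis
    by (simp add: in_l2_iff)
qed

lemma in_l2_diff:
  assumes "in_l2 m f" "in_l2 m g"
  shows "in_l2 m (\<lambda>x. f x - g x)"
  using in_l2_add[OF assms(1) in_l2_scaleR[OF assms(2), of "-1"]] by simp

lemma in_l2_zero: "in_l2 m (\<lambda>x. 0)"
  by (simp add: in_l2_def)

lemma in_l2_sum: "(\<And>i. i \<in> I \<Longrightarrow> in_l2 m (w i)) \<Longrightarrow> in_l2 m (\<lambda>x. \<Sum>i\<in>I. w i x)"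
  by (induction I rule: infinite_finite_induct) (auto simp: in_l2_zero intro: in_l2_add)

lemma in_l2_restrict:
  assumes "in_l2 m f"
  shows "in_l2 m (\<lambda>x. if x \<in> A then f x else 0)"
  unfolding in_l2_def
  by (rule summable_on_comparison_test[OF assms[unfolded in_l2_def]]) (auto simp: m_nonneg)

lemma ip_add_left:
  assumes "in_l2 m f" "in_l2 m g" "in_l2 m h"
  shows "ip (\<lambda>x. f x + g x) h = ip f h + ip g h"
  unfolding ip_def
  using infsum_add[OF ip_summable[OF assms(1,3)] ip_summable[OF assms(2,3)]]
  by (simp add: inner_add_left distrib_left)

lemma ip_scaleR_left: "ip (\<lambda>x. c *\<^sub>R f x) h = c * ip f h"
  unfolding ip_def by (simp add: mult.left_commute infsum_cmult_right')

lemma ip_diff_left: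
  assumes "in_l2 m f" "in_l2 m g" "in_l2 m h"
  shows "ip (\<lambda>x. f x - g x) h = ip f h - ip g h"
  using ip_add_left[OF assms(1) in_l2_scaleR[OF assms(2), of "-1"] assms(3)]
    ip_scaleR_left[of "-1" g h] by simp

lemma ip_add_right:
  "in_l2 m f \<Longrightarrow> in_l2 m g \<Longrightarrow> in_l2 m h \<Longrightarrow> ip h (\<lambda>x. f x + g x) = ip h f + ip h g"
  using ip_add_left[of f g h] by (simp add: ip_commute[of h])

lemma ip_diff_right:
  "in_l2 m f \<Longrightarrow> in_l2 m g \<Longrightarrow> in_l2 m h \<Longrightarrow> ip h (\<lambda>x. f x - g x) = ip h f - ip h g"
  using ip_diff_left[of f g h] by (simp add: ip_commute[of h])

lemma ip_scaleR_right: "ip h (\<lambda>x. c *\<^sub>R f x) = c * ip h f"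
  using ip_scaleR_left[of c f h] by (simp add: ip_commute[of h])

lemma ip_sum_left:
  assumes "\<And>i. i \<in> I \<Longrightarrow> in_l2 m (w i)" "in_l2 m h"
  shows "ip (\<lambda>x. \<Sum>i\<in>I. w i x) h = (\<Sum>i\<in>I. ip (w i) h)"
  using assms
proof (induction I rule: infinite_finite_induct)
  case (insert i I)
  then show ?case
    by (simp add: ip_add_left in_l2_sum)
qed (simp_all add: ip_def)

lemma sum_le_ip:
  assumes "in_l2 m f" "finite A"
  shows "(\<Sum>x\<in>A. m x * (f x \<bullet> f x)) \<le> ip f f"
  unfolding ip_def using assms
  by (intro finite_sum_le_infsum) (auto simp: in_l2_iff m_nonneg)

text \<open>A single term is at most the whole sum. This turns norm convergence into convergence at
  each vertex, as needed for \<open>heat\<close> and \<open>Lap\<close>, which are defined vertex by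
  vertex.\<close>

lemma l2norm_pointwise:
  assumes "in_l2 m f"
  shows "cmod (f x) * sqrt (m x) \<le> l2norm m f"
proof -
  have "(cmod (f x) * sqrt (m x))\<^sup>2 = (\<Sum>x\<in>{x}. m x * (f x \<bullet> f x))"
    by (simp add: power_mult_distrib m_nonneg power2_norm_eq_inner)
  also have "\<dots> \<le> (l2norm m f)\<^sup>2"
    unfolding l2norm_power2 using assms by (intro sum_le_ip) auto
  finally show ?thesis
    by (rule power2_le_imp_le) (rule l2norm_nonneg)
qed

lemma l2norm_scaleR: "l2norm m (\<lambda>x. c *\<^sub>R f x) = \<bar>c\<bar> * l2norm m f"
proof -
  have "ip (\<lambda>x. c *\<^sub>R f x) (\<lambda>x. c *\<^sub>R f x) = c\<^sup>2 * ip f f"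
    by (simp add: ip_scaleR_left ip_scaleR_right power2_eq_square)
  then show ?thesis
    by (simp add: l2norm_eq_sqrt_ip real_sqrt_mult)
qed

lemma ip_le:
  assumes f: "in_l2 m f" and g: "in_l2 m g"
  shows "ip f g \<le> l2norm m f * l2norm m g"
\<comment> \<open>A zero norm forces the zero function since \<open>m\<close> is positive. Otherwise
  the square of \<open>c *\<^sub>R f - a *\<^sub>R g\<close> is expanded, with \<open>a\<close> and
  \<open>c\<close> the norms of \<open>f\<close> and \<open>g\<close>, and the positive factor
  \<open>a * c\<close> is cancelled.\<close>
proof (cases "l2norm m f = 0 \<or> l2norm m g = 0")
  case True
  have "h x = 0" if "in_l2 m h" "l2norm m h = 0" for h x
    using l2norm_pointwise[OF that(1), of x] that(2) m_pos[of x]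
    by (simp add: mult_le_0_iff)
  then have "(\<forall>x. f x = 0) \<or> (\<forall>x. g x = 0)"
    using True f g by metis
  then have "ip f g = 0"
    by (auto simp: ip_def)
  then show ?thesis
    by (simp add: l2norm_nonneg)
next
  case False
  define a c where "a = l2norm m f" and "c = l2norm m g"
  have pos: "a > 0" "c > 0"
    using False l2norm_nonneg[of f] l2norm_nonneg[of g] by (auto simp: a_def c_def)
  let ?u = "\<lambda>x. c *\<^sub>R f x" and ?v = "\<lambda>x. a *\<^sub>R g x"
  have l2: "in_l2 m ?u" "in_l2 m ?v"
    using f g by (auto intro: in_l2_scaleR)
  have "0 \<le> ip (\<lambda>x. ?u x - ?v x) (\<lambda>x. ?u x - ?v x)"
    by (rule ip_self_nonneg)
  also have "\<dots> = (ip ?u ?u - ip ?u ?v) - (ip ?v ?u - ip ?v ?v)"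
    by (simp only: ip_diff_left ip_diff_right in_l2_diff l2)
  also have "\<dots> = c\<^sup>2 * a\<^sup>2 - 2 * (a * c * ip f g) + a\<^sup>2 * c\<^sup>2"
    by (simp add: ip_scaleR_left ip_scaleR_right ip_commute[of g f] a_def c_def flip: l2norm_power2)
      (simp add: power2_eq_square algebra_simps)
  finally have "(a * c) * ip f g \<le> (a * c) * (a * c)"
    by (simp add: power2_eq_square algebra_simps)
  then show ?thesis
    using pos by (simp add: a_def[symmetric] c_def[symmetric])
qed

lemma abs_ip_le:
  assumes "in_l2 m f" "in_l2 m g"
  shows "\<bar>ip f g\<bar> \<le> l2norm m f * l2norm m g"
  using ip_le[OF assms] ip_le[OF in_l2_scaleR[OF assms(1), of "-1"] assms(2)]
    ip_scaleR_left[of "-1" f g] l2norm_scaleR[of "-1" f] by simp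

lemma l2norm_add_le:
  assumes f: "in_l2 m f" and g: "in_l2 m g"
  shows "l2norm m (\<lambda>x. f x + g x) \<le> l2norm m f + l2norm m g"
proof (rule power2_le_imp_le)
  have "(l2norm m (\<lambda>x. f x + g x))\<^sup>2 = ip f f + 2 * ip f g + ip g g"
    unfolding l2norm_power2 using f g
    by (simp add: ip_add_left ip_add_right in_l2_add ip_commute[of g f])
  also have "\<dots> \<le> (l2norm m f + l2norm m g)\<^sup>2"
    using ip_le[OF assms] by (simp add: power2_sum l2norm_power2)
  finally show "(l2norm m (\<lambda>x. f x + g x))\<^sup>2 \<le> (l2norm m f + l2norm m g)\<^sup>2" .
qed (simp add: l2norm_nonneg)

lemma l2norm_sum_le:
  assumes "\<And>i. i \<in> I \<Longrightarrow> in_l2 m (w i)"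
  shows "l2norm m (\<lambda>x. \<Sum>i\<in>I. w i x) \<le> (\<Sum>i\<in>I. l2norm m (w i))"
  using assms
proof (induction I rule: infinite_finite_induct)
  case (insert i I)
  then have "l2norm m (\<lambda>x. w i x + (\<Sum>i\<in>I. w i x)) \<le> l2norm m (w i) + l2norm m (\<lambda>x. \<Sum>i\<in>I. w i x)"
    by (intro l2norm_add_le in_l2_sum) auto
  with insert show ?case
    by simp
qed (simp_all add: l2norm_def l2norm_on_def)

section \<open>Norm-dominated series in the weighted space\<close>

context
  fixes w :: "nat \<Rightarrow> 'a \<Rightarrow> complex" and \<beta> :: "nat \<Rightarrow> real"
  assumes w: "\<And>n. in_l2 m (w n)" and le: "\<And>n. l2norm m (w n) \<le> \<beta> n" and \<beta>: "summable \<beta>"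
begin

lemma series_summable: "summable (\<lambda>n. w n x)"
proof (rule summable_comparison_test')
  show "summable (\<lambda>n. \<beta> n / sqrt (m x))"
    using \<beta> by (rule summable_divide)
  show "norm (w n x) \<le> \<beta> n / sqrt (m x)" for n
    using l2norm_pointwise[OF w, of n x] le[of n] m_pos[of x]
    by (simp add: field_simps)
qed

text \<open>A Fatou argument: over a finite vertex set \<open>A\<close> the triangle inequality
  bounds the squared partial sums by \<open>(suminf \<beta>)\<^sup>2\<close>, the bound survives the
  limit in \<open>n\<close>, and the supremum over \<open>A\<close> gives the full norm.\<close>

lemma series_in_l2: "in_l2 m (\<lambda>x. \<Sum>n. w n x)" (is "in_l2 m ?S")
  and series_l2norm_le: "l2norm m (\<lambda>x. \<Sum>n. w n x) \<le> suminf \<beta>"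
proof -
  have \<beta>0: "\<beta> n \<ge> 0" for n
    using le[of n] l2norm_nonneg[of "w n"] by simp
  have bound: "(\<Sum>x\<in>A. m x * (?S x \<bullet> ?S x)) \<le> (suminf \<beta>)\<^sup>2" if "finite A" for A
  proof (rule LIMSEQ_le_const2)
    show "(\<lambda>n. \<Sum>x\<in>A. m x * ((\<Sum>i<n. w i x) \<bullet> (\<Sum>i<n. w i x)))
        \<longlonglongrightarrow> (\<Sum>x\<in>A. m x * (?S x \<bullet> ?S x))"
      by (intro tendsto_sum tendsto_mult tendsto_inner tendsto_const summable_LIMSEQ series_summable)
    have "(\<Sum>x\<in>A. m x * ((\<Sum>i<n. w i x) \<bullet> (\<Sum>i<n. w i x))) \<le> (suminf \<beta>)\<^sup>2" for n
    proof -
      have "(\<Sum>x\<in>A. m x * ((\<Sum>i<n. w i x) \<bullet> (\<Sum>i<n. w i x)))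
          \<le> (l2norm m (\<lambda>x. \<Sum>i<n. w i x))\<^sup>2"
        unfolding l2norm_power2 using that w by (intro sum_le_ip in_l2_sum)
      also have "\<dots> \<le> (suminf \<beta>)\<^sup>2"
      proof (rule power_mono)
        have "l2norm m (\<lambda>x. \<Sum>i<n. w i x) \<le> (\<Sum>i<n. l2norm m (w i))"
          using w by (rule l2norm_sum_le)
        also have "\<dots> \<le> (\<Sum>i<n. \<beta> i)"
          using le by (rule sum_mono)
        also have "\<dots> \<le> suminf \<beta>"
          using \<beta> \<beta>0 by (intro sum_le_suminf) auto
        finally show "l2norm m (\<lambda>x. \<Sum>i<n. w i x) \<le> suminf \<beta>" .
      qed (rule l2norm_nonneg)
      finally show ?thesis .
    qed
    then show "\<exists>N. \<forall>n\<ge>N. (\<Sum>x\<in>A. m x * ((\<Sum>i<n. w i x) \<bullet> (\<Sum>i<n. w i x))) \<le> (suminf \<beta>)\<^sup>2"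
      by blast
  qed
  show l2: "in_l2 m ?S"
    unfolding in_l2_iff using bound
    by (intro nonneg_bdd_above_summable_on bdd_aboveI[where M = "(suminf \<beta>)\<^sup>2"])
      (auto simp: m_nonneg)
  have "ip ?S ?S \<le> (suminf \<beta>)\<^sup>2"
    unfolding ip_def using l2 bound
    by (intro infsum_le_finite_sums) (auto simp: in_l2_iff)
  then have "(l2norm m ?S)\<^sup>2 \<le> (suminf \<beta>)\<^sup>2"
    by (simp add: l2norm_power2)
  then show "l2norm m ?S \<le> suminf \<beta>"
    by (rule power2_le_imp_le) (simp add: \<beta> \<beta>0 suminf_nonneg)
qed

end

text \<open>The remainder after \<open>k\<close> terms is again a dominated series, so its norm is
  at most the scalar tail.\<close>

lemma series_tail_tendsto:
  assumes w: "\<And>n. in_l2 m (w n)" and le: "\<And>n. l2norm m (w n) \<le> \<beta> n" and \<beta>: "summable \<beta>"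
  shows "(\<lambda>k. l2norm m (\<lambda>x. (\<Sum>n. w n x) - (\<Sum>n<k. w n x))) \<longlonglongrightarrow> 0"
proof (rule tendsto_sandwich[where f = "\<lambda>_. 0"])
  have eq: "(\<lambda>x. (\<Sum>n. w n x) - (\<Sum>n<k. w n x)) = (\<lambda>x. \<Sum>n. w (n + k) x)" for k
    by (rule ext, rule suminf_minus_initial_segment[OF series_summable[OF w le \<beta>], symmetric])
  show "\<forall>\<^sub>F k in sequentially. l2norm m (\<lambda>x. (\<Sum>n. w n x) - (\<Sum>n<k. w n x)) \<le> (\<Sum>n. \<beta> (n + k))"
    unfolding eq using w le \<beta>
    by (intro always_eventually allI series_l2norm_le) (simp_all add: summable_iff_shift)
  show "(\<lambda>k. \<Sum>n. \<beta> (n + k)) \<longlonglongrightarrow> 0"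
    using suminf_exist_split2[OF \<beta>] .
qed (auto simp: l2norm_nonneg)

text \<open>The partial sums converge in norm by the tail estimate, and \<open>ip\<close> is
  continuous in norm by Cauchy-Schwarz.\<close>

lemma series_ip_sums:
  assumes w: "\<And>n. in_l2 m (w n)" and le: "\<And>n. l2norm m (w n) \<le> \<beta> n" and \<beta>: "summable \<beta>"
    and v: "in_l2 m v"
  shows "(\<lambda>n. ip (w n) v) sums ip (\<lambda>x. \<Sum>n. w n x) v"
  unfolding sums_def
proof (rule LIM_zero_cancel, rule tendsto_rabs_zero_cancel, rule tendsto_sandwich[where f = "\<lambda>_. 0"])
  let ?S = "\<lambda>x. \<Sum>n. w n x"
  have S: "in_l2 m ?S"
    by (rule series_in_l2[OF w le \<beta>])
  show "\<forall>\<^sub>F k in sequentially. \<bar>(\<Sum>n<k. ip (w n) v) - ip ?S v\<bar>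
      \<le> l2norm m (\<lambda>x. ?S x - (\<Sum>n<k. w n x)) * l2norm m v"
  proof (intro always_eventually allI)
    fix k
    have "ip (\<lambda>x. ?S x - (\<Sum>n<k. w n x)) v = ip ?S v - (\<Sum>n<k. ip (w n) v)"
      using S w v by (simp add: ip_diff_left ip_sum_left in_l2_sum)
    moreover have "\<bar>ip (\<lambda>x. ?S x - (\<Sum>n<k. w n x)) v\<bar>
        \<le> l2norm m (\<lambda>x. ?S x - (\<Sum>n<k. w n x)) * l2norm m v"
      using S w v by (intro abs_ip_le in_l2_diff in_l2_sum)
    ultimately show "\<bar>(\<Sum>n<k. ip (w n) v) - ip ?S v\<bar>
      \<le> l2norm m (\<lambda>x. ?S x - (\<Sum>n<k. w n x)) * l2norm m v"
      by (simp add: abs_minus_commute)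
  qed
  show "(\<lambda>k. l2norm m (\<lambda>x. ?S x - (\<Sum>n<k. w n x)) * l2norm m v) \<longlonglongrightarrow> 0"
    using tendsto_mult_right[OF series_tail_tendsto[OF w le \<beta>], of "l2norm m v"] by simp
qed auto

end

section \<open>Infinite sums and exponential moment series\<close>

lemma Cauchy_Schwarz_infsum:
  fixes z :: "'a \<Rightarrow> 'b::real_normed_vector" and a :: "'a \<Rightarrow> real"
  assumes a: "\<And>x. a x \<ge> 0" "a summable_on A"
    and az: "(\<lambda>x. a x *\<^sub>R z x) summable_on A" "(\<lambda>x. a x * (norm (z x))\<^sup>2) summable_on A"
  shows "(norm (\<Sum>\<^sub>\<infinity>x\<in>A. a x *\<^sub>R z x))\<^sup>2 \<le> (\<Sum>\<^sub>\<infinity>x\<in>A. a x) * (\<Sum>\<^sub>\<infinity>x\<in>A. a x * (norm (z x))\<^sup>2)"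
proof (rule tendsto_upperbound)
  show "((\<lambda>F. (norm (\<Sum>x\<in>F. a x *\<^sub>R z x))\<^sup>2) \<longlongrightarrow> (norm (\<Sum>\<^sub>\<infinity>x\<in>A. a x *\<^sub>R z x))\<^sup>2) (finite_subsets_at_top A)"
    by (intro tendsto_power tendsto_norm infsum_tendsto az)
  show "\<forall>\<^sub>F F in finite_subsets_at_top A. (norm (\<Sum>x\<in>F. a x *\<^sub>R z x))\<^sup>2
      \<le> (\<Sum>\<^sub>\<infinity>x\<in>A. a x) * (\<Sum>\<^sub>\<infinity>x\<in>A. a x * (norm (z x))\<^sup>2)"
  proof (rule eventually_finite_subsets_at_top_weakI)
    fix F assume F: "finite F" "F \<subseteq> A"
    have "norm (\<Sum>x\<in>F. a x *\<^sub>R z x) \<le> (\<Sum>x\<in>F. sqrt (a x) * (sqrt (a x) * norm (z x)))"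
      using a by (intro sum_norm_le) (simp flip: mult.assoc)
    then have "(norm (\<Sum>x\<in>F. a x *\<^sub>R z x))\<^sup>2 \<le> (\<Sum>x\<in>F. sqrt (a x) * (sqrt (a x) * norm (z x)))\<^sup>2"
      by (rule power_mono) simp
    also have "\<dots> \<le> (\<Sum>x\<in>F. (sqrt (a x))\<^sup>2) * (\<Sum>x\<in>F. (sqrt (a x) * norm (z x))\<^sup>2)"
      by (rule Cauchy_Schwarz_ineq_sum)
    also have "\<dots> = (\<Sum>x\<in>F. a x) * (\<Sum>x\<in>F. a x * (norm (z x))\<^sup>2)"
      using a by (simp add: power_mult_distrib)
    also have "\<dots> \<le> (\<Sum>\<^sub>\<infinity>x\<in>A. a x) * (\<Sum>\<^sub>\<infinity>x\<in>A. a x * (norm (z x))\<^sup>2)"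
      using a az F by (intro mult_mono finite_sum_le_infsum infsum_nonneg sum_nonneg) auto
    finally show "(norm (\<Sum>x\<in>F. a x *\<^sub>R z x))\<^sup>2
        \<le> (\<Sum>\<^sub>\<infinity>x\<in>A. a x) * (\<Sum>\<^sub>\<infinity>x\<in>A. a x * (norm (z x))\<^sup>2)" .
  qed
qed simp

section \<open>Exponential series whose coefficients grow geometrically\<close>

lemma summable_exp_moment:
  fixes \<mu> :: "nat \<Rightarrow> real"
  assumes \<mu>: "\<And>n. \<bar>\<mu> n\<bar> \<le> C * R ^ n"
  shows "summable (\<lambda>n. s ^ n / fact n * \<mu> n)"
proof (rule summable_comparison_test')
  show "summable (\<lambda>n. C * ((\<bar>s\<bar> * R) ^ n /\<^sub>R fact n))"
    by (intro summable_mult summable_exp_generic)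
  show "norm (s ^ n / fact n * \<mu> n) \<le> C * ((\<bar>s\<bar> * R) ^ n /\<^sub>R fact n)" for n
    using mult_left_mono[OF \<mu>[of n], of "\<bar>s\<bar> ^ n / fact n"]
    by (simp add: abs_mult power_abs power_mult_distrib field_simps)
qed

text \<open>The scalar shape of e^(sH) e^(tH) = e^((s+t)H), with \<open>\<mu> n\<close> in the role
  of the moment \<langle>H^n u, v\<rangle>. Geometric growth makes the double series absolutely
  summable, so it may be regrouped along \<open>n = j + k\<close> and summed by the binomial
  theorem.\<close>

lemma exp_moment_Cauchy_product:
  fixes \<mu> :: "nat \<Rightarrow> real"
  assumes \<mu>: "\<And>n. \<bar>\<mu> n\<bar> \<le> C * R ^ n" and R: "R \<ge> 0"
  shows "(\<Sum>j. s ^ j / fact j * (\<Sum>k. t ^ k / fact k * \<mu> (j + k))) = (\<Sum>n. (s + t) ^ n / fact n * \<mu> n)"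
proof -
  define g where "g = (\<lambda>(j, k). s ^ j / fact j * (t ^ k / fact k * \<mu> (j + k)))"
  define e where "e = (\<lambda>r n. (r * R) ^ n /\<^sub>R fact n :: real)"
  have C: "C \<ge> 0"
    using \<mu>[of 0] by simp
  have sum_e: "e \<bar>r\<bar> summable_on UNIV" for r
    unfolding e_def using R
    by (subst summable_on_UNIV_nonneg_real_iff) (auto simp del: real_scaleR_def intro: summable_exp_generic scaleR_nonneg_nonneg)
  have e_nonneg: "e \<bar>r\<bar> n \<ge> 0" for r n
    using R by (simp add: e_def)
  \<comment> \<open>Majorant: a product of two convergent exponential series, with
    \<open>R ^ (j + k)\<close> split between the factors.\<close>
  have ee: "(\<lambda>(j, k). C * (e \<bar>s\<bar> j * e \<bar>t\<bar> k)) summable_on UNIV \<times> UNIV"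
    using sum_e[of s] sum_e[of t] e_nonneg C
    by (intro summable_on_SigmaI[where g = "\<lambda>j. C * (e \<bar>s\<bar> j * infsum (e \<bar>t\<bar>) UNIV)"]
          summable_on_cmult_right summable_on_cmult_left)
      (auto intro!: has_sum_cmult_right has_sum_infsum)
  have g: "(\<lambda>jk. norm (g jk)) summable_on UNIV \<times> UNIV"
  proof (rule summable_on_comparison_test[OF ee])
    show "norm (g jk) \<le> (case jk of (j, k) \<Rightarrow> C * (e \<bar>s\<bar> j * e \<bar>t\<bar> k))" for jk
    proof (cases jk)
      case (Pair j k)
      have "norm (g jk) = (\<bar>s\<bar> ^ j / fact j * (\<bar>t\<bar> ^ k / fact k)) * \<bar>\<mu> (j + k)\<bar>"
        by (simp add: g_def Pair abs_mult power_abs)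
      also have "\<dots> \<le> (\<bar>s\<bar> ^ j / fact j * (\<bar>t\<bar> ^ k / fact k)) * (C * R ^ (j + k))"
        by (intro mult_left_mono \<mu>) simp
      also have "\<dots> = C * (e \<bar>s\<bar> j * e \<bar>t\<bar> k)"
        by (simp add: e_def power_mult_distrib power_add field_simps)
      finally show ?thesis
        by (simp add: Pair)
    qed
  qed auto
  then have g': "g summable_on UNIV \<times> UNIV"
    by (rule abs_summable_summable)
  have "(\<Sum>j. s ^ j / fact j * (\<Sum>k. t ^ k / fact k * \<mu> (j + k))) = infsum g (UNIV \<times> UNIV)"
  proof -
    have hs: "((\<lambda>k. g (j, k)) has_sum (\<Sum>\<^sub>\<infinity>k. g (j, k))) UNIV" for j
      using summable_on_SigmaD1[of "\<lambda>j k. g (j, k)" UNIV "\<lambda>_. UNIV" j] g'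
      by (intro has_sum_infsum) simp
    have "(\<lambda>k. t ^ k / fact k * \<mu> (j + k)) sums (\<Sum>k. t ^ k / fact k * \<mu> (j + k))" for j
    proof (rule summable_sums, rule summable_exp_moment)
      show "\<bar>\<mu> (j + k)\<bar> \<le> (C * R ^ j) * R ^ k" for k
        using \<mu>[of "j + k"] by (simp add: power_add mult_ac)
    qed
    then have "(\<lambda>k. g (j, k)) sums (s ^ j / fact j * (\<Sum>k. t ^ k / fact k * \<mu> (j + k)))" for j
      unfolding g_def prod.case by (rule sums_mult)
    with hs[THEN has_sum_imp_sums]
    have row: "(\<Sum>\<^sub>\<infinity>k. g (j, k)) = s ^ j / fact j * (\<Sum>k. t ^ k / fact k * \<mu> (j + k))" for j
      by (rule sums_unique2)
    have "((\<lambda>j. \<Sum>\<^sub>\<infinity>k. g (j, k)) has_sum infsum g (UNIV \<times> UNIV)) UNIV"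
      using has_sum_SigmaD[OF has_sum_infsum[OF g'] hs] .
    from has_sum_imp_sums[OF this] show ?thesis
      unfolding row by (rule sums_unique[symmetric])
  qed
  \<comment> \<open>Antidiagonals: the pair \<open>(j, k)\<close> becomes \<open>(n, i)\<close> with
    \<open>n = j + k\<close> and \<open>i = j\<close>.\<close>
  also have "\<dots> = infsum (\<lambda>(n, i). g (i, n - i)) (SIGMA n:UNIV. {..n})"
    by (rule infsum_reindex_bij_witness[where i = "\<lambda>(n, i). (i, n - i)" and j = "\<lambda>(j, k). (j + k, j)"]) auto
  also have "\<dots> = (\<Sum>n. (s + t) ^ n / fact n * \<mu> n)"
  proof -
    let ?h = "\<lambda>(n, i). g (i, n - i)"
    have h: "?h summable_on (SIGMA n:UNIV. {..n})"
      using g' summable_on_reindex_bij_witness[of "UNIV \<times> UNIV" "\<lambda>(n, i). (i, n - i)" "\<lambda>(j, k). (j + k, j)"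
          "SIGMA n:UNIV. {..n}" ?h g] by auto
    have row: "((\<lambda>i. ?h (n, i)) has_sum ((s + t) ^ n / fact n * \<mu> n)) {..n}" for n
    proof (rule has_sum_finiteI)
      have "(s + t) ^ n / fact n = (\<Sum>i\<le>n. (s ^ i / fact i) * (t ^ (n - i) / fact (n - i)))"
        using exp_series_add_commuting[of s t n] by (simp add: field_simps)
      then show "(s + t) ^ n / fact n * \<mu> n = (\<Sum>i\<le>n. ?h (n, i))"
        by (simp add: sum_distrib_right g_def mult.assoc)
    qed simp
    from has_sum_imp_sums[OF has_sum_SigmaD[OF has_sum_infsum[OF h] row]] show ?thesis
      by (rule sums_unique)
  qed
  finally show ?thesis .
qed

text \<open>A power series is differentiated term by term; the factorial absorbs the factor
  \<open>n + 1\<close> and the moments shift by one.\<close>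

lemma DERIV_exp_moment:
  fixes \<mu> :: "nat \<Rightarrow> real"
  assumes \<mu>: "\<And>n. \<bar>\<mu> n\<bar> \<le> C * R ^ n"
  shows "((\<lambda>s. \<Sum>n. s ^ n / fact n * \<mu> n) has_real_derivative (\<Sum>n. s ^ n / fact n * \<mu> (Suc n))) (at s)"
proof -
  have "((\<lambda>s. \<Sum>n. \<mu> n / fact n * s ^ n) has_real_derivative (\<Sum>n. diffs (\<lambda>n. \<mu> n / fact n) n * s ^ n)) (at s)"
  proof (rule termdiffs_strong_converges_everywhere)
    show "summable (\<lambda>n. \<mu> n / fact n * y ^ n)" for y
      using summable_exp_moment[OF \<mu>, of y] by (simp add: mult_ac)
  qed
  moreover have "diffs (\<lambda>n. \<mu> n / fact n) n = \<mu> (Suc n) / fact n" for n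
    by (simp add: diffs_def del: of_nat_Suc)
  ultimately show ?thesis
    by (simp add: mult_ac)
qed

section \<open>The Laplacian and its energy form\<close>

lemma abs_inner_le:
  fixes z w :: "'a::real_inner"
  shows "2 * \<bar>z \<bullet> w\<bar> \<le> z \<bullet> z + w \<bullet> w"
  using Cauchy_Schwarz_ineq2[of z w] sum_squares_bound[of "norm z" "norm w"]
  unfolding power2_norm_eq_inner by linarith

lemma inner_diff_self_le:
  fixes z w :: "'a::real_inner"
  shows "(z - w) \<bullet> (z - w) \<le> 2 * (z \<bullet> z + w \<bullet> w)"
  using abs_inner_le[of z w] by (simp add: inner_diff inner_commute)

lemma abs_inner_diff_le:
  fixes z w v :: "'a::real_inner"
  shows "\<bar>(z - w) \<bullet> v\<bar> \<le> z \<bullet> z + w \<bullet> w + v \<bullet> v"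
proof -
  have "2 * \<bar>(z - w) \<bullet> v\<bar> \<le> 2 * (z \<bullet> z + w \<bullet> w) + v \<bullet> v"
    using abs_inner_le[of "z - w" v] inner_diff_self_le[of z w] by linarith
  moreover have "a \<le> c + d" if "2 * a \<le> 2 * c + d" "0 \<le> d" for a c d :: real
    using that by linarith
  ultimately show ?thesis
    using inner_ge_zero by blast
qed

locale bounded_graph =
  fixes b :: "'a::countable \<Rightarrow> 'a \<Rightarrow> real" and m :: "'a \<Rightarrow> real"
  assumes graph: "weighted_graph b m" and bounded_degree: "bounded_degree b m"
begin

sublocale weighted_space m
  using graph by unfold_locales (simp add: weighted_graph_def)

lemma b_nonneg: "b x y \<ge> 0" and b_sym: "b x y = b y x" and b_summable: "b x summable_on UNIV"
  using graph by (auto simp: weighted_graph_def)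

definition M :: real where "M = (SUP x. Deg b m x)"

lemma b_row_le: "(\<Sum>\<^sub>\<infinity>y. b x y) \<le> M * m x"
proof -
  have "Deg b m x \<le> M"
    unfolding M_def using bounded_degree by (intro cSUP_upper) (auto simp: bounded_degree_def)
  then show ?thesis
    using m_pos[of x] by (simp add: Deg_def field_simps)
qed

lemma M_nonneg: "M \<ge> 0"
proof -
  have "0 \<le> (\<Sum>\<^sub>\<infinity>y. b undefined y)"
    by (intro infsum_nonneg b_nonneg)
  then have "0 \<le> M * m undefined"
    using b_row_le[of undefined] by (rule order_trans)
  then show ?thesis
    using m_pos[of undefined] by (simp add: zero_le_mult_iff)
qed

text \<open>Tonelli with the sum over \<open>y\<close> taken first: the row sum of \<open>b\<close>
  at \<open>x\<close> is at most \<open>M * m x\<close>, which turns edge sums into vertex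
  sums.\<close>

lemma fst_summable:
  assumes "in_l2 m f"
  shows "(\<lambda>(x, y). b x y * (f x \<bullet> f x)) summable_on UNIV"
    and "(\<Sum>\<^sub>\<infinity>(x, y). b x y * (f x \<bullet> f x)) \<le> M * ip f f"
proof -
  let ?g = "\<lambda>x. (\<Sum>\<^sub>\<infinity>y. b x y) * (f x \<bullet> f x)"
  have row: "((\<lambda>y. case (x, y) of (x, y) \<Rightarrow> b x y * (f x \<bullet> f x)) has_sum ?g x) UNIV" for x
    by (simp add: b_summable has_sum_cmult_left)
  have le: "?g x \<le> M * (m x * (f x \<bullet> f x))" for x
    using mult_right_mono[OF b_row_le[of x], of "f x \<bullet> f x"] by (simp add: mult.assoc)
  have l2: "(\<lambda>x. M * (m x * (f x \<bullet> f x))) summable_on UNIV"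
    using assms by (intro summable_on_cmult_right) (simp add: in_l2_iff)
  have g: "?g summable_on UNIV"
    using le by (intro summable_on_comparison_test[OF l2]) (auto intro!: mult_nonneg_nonneg infsum_nonneg b_nonneg)
  have *: "(\<lambda>(x, y). b x y * (f x \<bullet> f x)) summable_on UNIV \<times> UNIV"
    by (rule summable_on_SigmaI[OF row g]) (simp add: b_nonneg)
  then show "(\<lambda>(x, y). b x y * (f x \<bullet> f x)) summable_on UNIV"
    by simp
  have "(\<Sum>\<^sub>\<infinity>(x, y). b x y * (f x \<bullet> f x)) = (\<Sum>\<^sub>\<infinity>x. ?g x)"
    using has_sum_SigmaD[OF has_sum_infsum[OF *] row] by (simp add: infsumI)
  also have "\<dots> \<le> (\<Sum>\<^sub>\<infinity>x. M * (m x * (f x \<bullet> f x)))"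
    using g l2 le by (intro infsum_mono)
  also have "\<dots> = M * ip f f"
    by (simp add: ip_def infsum_cmult_right')
  finally show "(\<Sum>\<^sub>\<infinity>(x, y). b x y * (f x \<bullet> f x)) \<le> M * ip f f" .
qed

lemma infsum_prod_swap:
  fixes F :: "'a \<Rightarrow> 'a \<Rightarrow> real"
  shows "(\<lambda>(x, y). F y x) summable_on UNIV \<longleftrightarrow> (\<lambda>(x, y). F x y) summable_on UNIV"
    and "(\<Sum>\<^sub>\<infinity>(x, y). F y x) = (\<Sum>\<^sub>\<infinity>(x, y). F x y)"
proof -
  have bij: "bij_betw prod.swap UNIV (UNIV :: ('a \<times> 'a) set)"
    by simp
  have eq: "(\<lambda>p. (\<lambda>(x, y). F x y) (prod.swap p)) = (\<lambda>(x, y). F y x)"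
    by auto
  show "(\<lambda>(x, y). F y x) summable_on UNIV \<longleftrightarrow> (\<lambda>(x, y). F x y) summable_on UNIV"
    using summable_on_reindex_bij_betw[OF bij, of "\<lambda>(x, y). F x y"] by (simp only: eq)
  show "(\<Sum>\<^sub>\<infinity>(x, y). F y x) = (\<Sum>\<^sub>\<infinity>(x, y). F x y)"
    using infsum_reindex_bij_betw[OF bij, of "\<lambda>(x, y). F x y"] by (simp only: eq)
qed

lemma snd_summable:
  assumes "in_l2 m f"
  shows "(\<lambda>(x, y). b x y * (f y \<bullet> f y)) summable_on UNIV"
    and "(\<Sum>\<^sub>\<infinity>(x, y). b x y * (f y \<bullet> f y)) \<le> M * ip f f"
  using fst_summable[OF assms] infsum_prod_swap[of "\<lambda>x y. b x y * (f x \<bullet> f x)"]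
  by (simp_all add: b_sym)

lemma grad_inner_summable:
  assumes f: "in_l2 m f" and g: "in_l2 m g"
  shows "(\<lambda>(x, y). b x y * ((f x - f y) \<bullet> g x)) summable_on UNIV"
proof (rule abs_summable_summable, rule summable_on_comparison_test)
  let ?F = "\<lambda>(x, y). b x y * (f x \<bullet> f x) + b x y * (f y \<bullet> f y) + b x y * (g x \<bullet> g x)"
  show "?F summable_on UNIV"
    using summable_on_add[OF summable_on_add[OF fst_summable(1)[OF f] snd_summable(1)[OF f]] fst_summable(1)[OF g]]
    by (simp add: case_prod_unfold)
  show "norm ((\<lambda>(x, y). b x y * ((f x - f y) \<bullet> g x)) p) \<le> ?F p" for p
  proof (cases p)
    case (Pair x y)
    show ?thesis
      using mult_left_mono[OF abs_inner_diff_le b_nonneg[of x y], of "f x" "f y" "g x"]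
      by (simp add: Pair abs_mult b_nonneg distrib_left)
  qed
qed auto

text \<open>The Dirichlet form. The sum runs over ordered pairs, so each edge occurs twice and the
  division by \<open>2\<close> compensates.\<close>

definition energy :: "('a \<Rightarrow> complex) \<Rightarrow> ('a \<Rightarrow> complex) \<Rightarrow> real" where
  "energy f g = (\<Sum>\<^sub>\<infinity>(x, y). b x y * ((f x - f y) \<bullet> (g x - g y))) / 2"

lemma energy_commute: "energy f g = energy g f"
  by (simp add: energy_def inner_commute)

lemma energy_summable:
  assumes f: "in_l2 m f"
  shows "(\<lambda>(x, y). b x y * ((f x - f y) \<bullet> (f x - f y))) summable_on UNIV"
proof (rule summable_on_comparison_test)
  let ?F = "\<lambda>(x, y). 2 * (b x y * (f x \<bullet> f x) + b x y * (f y \<bullet> f y))"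
  show "?F summable_on UNIV"
    using summable_on_cmult_right[OF summable_on_add[OF fst_summable(1)[OF f] snd_summable(1)[OF f]], of 2]
    by (simp add: case_prod_unfold)
  show "(\<lambda>(x, y). b x y * ((f x - f y) \<bullet> (f x - f y))) p \<le> ?F p" for p
  proof (cases p)
    case (Pair x y)
    then show ?thesis
      using mult_left_mono[OF inner_diff_self_le b_nonneg[of x y], of "f x" "f y"] by (simp add: algebra_simps)
  qed
qed (auto simp: b_nonneg)

lemma energy_nonneg: "energy f f \<ge> 0"
  unfolding energy_def by (auto intro!: infsum_nonneg simp: b_nonneg)

lemma energy_le: "in_l2 m f \<Longrightarrow> energy f f \<le> 2 * M * ip f f"
proof -
  assume f: "in_l2 m f"
  let ?F = "\<lambda>(x, y). b x y * (f x \<bullet> f x)" and ?G = "\<lambda>(x, y). b x y * (f y \<bullet> f y)"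
  have FG: "?F summable_on UNIV" "?G summable_on UNIV"
    using f by (rule fst_summable snd_summable)+
  have "2 * energy f f = (\<Sum>\<^sub>\<infinity>(x, y). b x y * ((f x - f y) \<bullet> (f x - f y)))"
    by (simp add: energy_def)
  also have "\<dots> \<le> (\<Sum>\<^sub>\<infinity>p. 2 * (?F p + ?G p))"
  proof (rule infsum_mono)
    show "(\<lambda>(x, y). b x y * ((f x - f y) \<bullet> (f x - f y))) summable_on UNIV"
      using f by (rule energy_summable)
    show "(\<lambda>p. 2 * (?F p + ?G p)) summable_on UNIV"
      by (intro summable_on_cmult_right summable_on_add FG)
    show "(\<lambda>(x, y). b x y * ((f x - f y) \<bullet> (f x - f y))) p \<le> 2 * (?F p + ?G p)" for p
    proof (cases p)
      case (Pair x y)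
      then show ?thesis
        using mult_left_mono[OF inner_diff_self_le b_nonneg[of x y], of "f x" "f y"] by (simp add: algebra_simps)
    qed
  qed
  also have "\<dots> = 2 * (infsum ?F UNIV + infsum ?G UNIV)"
    by (simp only: infsum_cmult_right' infsum_add FG)
  also have "\<dots> \<le> 2 * (M * ip f f + M * ip f f)"
    using fst_summable(2)[OF f] snd_summable(2)[OF f] by (intro mult_left_mono add_mono) auto
  finally show ?thesis
    by simp
qed

text \<open>The energy sum over all pairs restricts to the row at \<open>x\<close>; the first-order
  terms then follow from \<open>t \<le> 1 + t\<^sup>2\<close> and the summability of the row
  \<open>b x\<close>.\<close>

lemma Lap_summand_summable:
  assumes f: "in_l2 m f"
  shows "(\<lambda>y. b x y *\<^sub>R (f x - f y)) summable_on UNIV"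
    and "(\<lambda>y. b x y * (norm (f x - f y))\<^sup>2) summable_on UNIV"
proof -
  show sq: "(\<lambda>y. b x y * (norm (f x - f y))\<^sup>2) summable_on UNIV"
    using summable_on_SigmaD1[of "\<lambda>x y. b x y * ((f x - f y) \<bullet> (f x - f y))" UNIV "\<lambda>_. UNIV" x]
      energy_summable[OF f] by (simp add: power2_norm_eq_inner)
  show "(\<lambda>y. b x y *\<^sub>R (f x - f y)) summable_on UNIV"
  proof (rule abs_summable_summable, rule summable_on_comparison_test)
    show "(\<lambda>y. b x y + b x y * (norm (f x - f y))\<^sup>2) summable_on UNIV"
      using sq b_summable by (intro summable_on_add)
    show "norm (b x y *\<^sub>R (f x - f y)) \<le> b x y + b x y * (norm (f x - f y))\<^sup>2" for y
    proof -
      have "norm (f x - f y) \<le> 1 + (norm (f x - f y))\<^sup>2"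
        using sum_squares_bound[of 1 "norm (f x - f y)"] norm_ge_zero[of "f x - f y"] by (simp del: norm_ge_zero)
      from mult_left_mono[OF this b_nonneg[of x y]] show ?thesis
        unfolding norm_scaleR by (simp add: b_nonneg distrib_left)
    qed
  qed auto
qed

lemma Lap_eq: "Lap b m f x = (1 / m x) *\<^sub>R (\<Sum>\<^sub>\<infinity>y. b x y *\<^sub>R (f x - f y))"
  by (simp add: Lap_def scaleR_conv_of_real field_simps)

text \<open>Green's formula. Summing \<open>?A\<close> row by row gives the inner product.
  Exchanging \<open>x\<close> and \<open>y\<close> leaves the sum unchanged, and by the symmetry of
  \<open>b\<close> both versions together make twice the energy.\<close>

lemma ip_Lap_left:
  assumes f: "in_l2 m f" and g: "in_l2 m g"
  shows "ip (Lap b m f) g = energy f g"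
proof -
  let ?A = "\<lambda>x y. b x y * ((f x - f y) \<bullet> g x)"
  have A: "(\<lambda>(x, y). ?A x y) summable_on UNIV"
    using f g by (rule grad_inner_summable)
  have row: "((\<lambda>y. ?A x y) has_sum (m x * (Lap b m f x \<bullet> g x))) UNIV" for x
  proof -
    have "((\<lambda>y. (b x y *\<^sub>R (f x - f y)) \<bullet> g x) has_sum ((\<Sum>\<^sub>\<infinity>y. b x y *\<^sub>R (f x - f y)) \<bullet> g x)) UNIV"
      by (rule has_sum_bounded_linear[OF bounded_linear_inner_left has_sum_infsum[OF Lap_summand_summable(1)[OF f]]])
    then show ?thesis
      using m_pos[of x] by (simp add: Lap_eq del: scaleR_complex.sel)
  qed
  have "ip (Lap b m f) g = (\<Sum>\<^sub>\<infinity>(x, y). ?A x y)"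
    using has_sum_SigmaD[where f = "\<lambda>(x, y). ?A x y" and B = "\<lambda>_. UNIV" and A = UNIV] A row
    unfolding ip_def by (intro infsumI) auto
  moreover have "2 * energy f g = (\<Sum>\<^sub>\<infinity>(x, y). ?A x y) + (\<Sum>\<^sub>\<infinity>(x, y). ?A y x)"
  proof -
    have "(\<Sum>\<^sub>\<infinity>(x, y). ?A x y) + (\<Sum>\<^sub>\<infinity>(x, y). ?A y x)
        = (\<Sum>\<^sub>\<infinity>p. (\<lambda>(x, y). ?A x y) p + (\<lambda>(x, y). ?A y x) p)"
      using A infsum_prod_swap(1)[of ?A] by (intro infsum_add[symmetric]) auto
    also have "\<dots> = 2 * energy f g"
      unfolding energy_def
      by (auto intro!: infsum_cong simp: b_sym inner_diff algebra_simps)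
    finally show ?thesis ..
  qed
  ultimately show ?thesis
    using infsum_prod_swap(2)[of ?A] by simp
qed

text \<open>Cauchy-Schwarz over the row with weights \<open>b x y\<close>. The row bound
  \<open>M * m x\<close> and the outer factor \<open>m x\<close> cancel the two factors
  \<open>1 / m x\<close> of the Laplacian.\<close>

lemma Lap_power2_le:
  assumes f: "in_l2 m f"
  shows "m x * (Lap b m f x \<bullet> Lap b m f x) \<le> M * (\<Sum>\<^sub>\<infinity>y. b x y * ((f x - f y) \<bullet> (f x - f y)))"
proof -
  let ?N = "(norm (\<Sum>\<^sub>\<infinity>y. b x y *\<^sub>R (f x - f y)))\<^sup>2"
  let ?Q = "\<Sum>\<^sub>\<infinity>y. b x y * (norm (f x - f y))\<^sup>2"
  have "?N \<le> (\<Sum>\<^sub>\<infinity>y. b x y) * ?Q"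
    using f by (intro Cauchy_Schwarz_infsum b_nonneg b_summable Lap_summand_summable)
  also have "\<dots> \<le> (M * m x) * ?Q"
    by (intro mult_right_mono b_row_le infsum_nonneg mult_nonneg_nonneg b_nonneg) simp
  finally have "?N / m x \<le> M * ?Q"
    using m_pos[of x] by (simp add: field_simps)
  moreover have "m x * (norm (Lap b m f x))\<^sup>2 = ?N / m x"
    using m_pos[of x] by (simp add: Lap_eq power_divide power2_eq_square)
  ultimately show ?thesis
    by (simp add: power2_norm_eq_inner)
qed

text \<open>Summing the preceding bound over \<open>x\<close> gives at most \<open>2 * M\<close>
  times the energy, which is itself at most \<open>2 * M\<close> times the squared norm.\<close>

lemma Lap_in_l2: "in_l2 m f \<Longrightarrow> in_l2 m (Lap b m f)"
  and ip_Lap_Lap_le: "in_l2 m f \<Longrightarrow> ip (Lap b m f) (Lap b m f) \<le> (2 * M)\<^sup>2 * ip f f"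
proof -
  assume f: "in_l2 m f"
  let ?e = "\<lambda>x. M * (\<Sum>\<^sub>\<infinity>y. b x y * ((f x - f y) \<bullet> (f x - f y)))"
  have E: "((\<lambda>(x, y). b x y * ((f x - f y) \<bullet> (f x - f y))) has_sum (2 * energy f f)) (UNIV \<times> UNIV)"
    using has_sum_infsum[OF energy_summable[OF f]] by (simp add: energy_def)
  have e: "(?e has_sum (M * (2 * energy f f))) UNIV"
    using Lap_summand_summable(2)[OF f]
    by (intro has_sum_cmult_right has_sum_SigmaD[OF E]) (simp add: power2_norm_eq_inner)
  have l2: "(\<lambda>x. m x * (Lap b m f x \<bullet> Lap b m f x)) summable_on UNIV"
    using Lap_power2_le[OF f]
    by (rule summable_on_comparison_test[OF has_sum_imp_summable[OF e]]) (simp add: m_nonneg)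
  then show "in_l2 m (Lap b m f)"
    by (simp add: in_l2_iff)
  have "ip (Lap b m f) (Lap b m f) \<le> infsum ?e UNIV"
    unfolding ip_def using l2 e Lap_power2_le[OF f] by (intro infsum_mono) (auto simp: summable_on_def)
  also have "\<dots> = M * (2 * energy f f)"
    using e by (rule infsumI)
  also have "\<dots> \<le> M * (2 * (2 * M * ip f f))"
    using energy_le[OF f] M_nonneg by (intro mult_left_mono) auto
  finally show "ip (Lap b m f) (Lap b m f) \<le> (2 * M)\<^sup>2 * ip f f"
    by (simp add: power2_eq_square mult_ac)
qed

lemma l2norm_Lap_le: "in_l2 m f \<Longrightarrow> l2norm m (Lap b m f) \<le> 2 * M * l2norm m f"
  using real_sqrt_le_mono[OF ip_Lap_Lap_le[of f]] M_nonneg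
  by (simp add: l2norm_eq_sqrt_ip real_sqrt_mult)

lemma Lap_symmetric: "in_l2 m f \<Longrightarrow> in_l2 m g \<Longrightarrow> ip (Lap b m f) g = ip f (Lap b m g)"
  using ip_Lap_left[of f g] ip_Lap_left[of g f] by (simp add: energy_commute ip_commute[of f])

end

section \<open>The heat semigroup\<close>

context bounded_graph
begin

section \<open>Linearity of the Laplacian and moments of its powers\<close>

lemma Lap_has_sum:
  assumes "in_l2 m f"
  shows "((\<lambda>y. b x y *\<^sub>R (f x - f y)) has_sum (m x *\<^sub>R Lap b m f x)) UNIV"
  using has_sum_infsum[OF Lap_summand_summable(1)[OF assms, of x]] m_pos[of x]
  by (simp add: Lap_eq)

lemma Lap_eqI:
  assumes "((\<lambda>y. b x y *\<^sub>R (f x - f y)) has_sum (m x *\<^sub>R l)) UNIV"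
  shows "Lap b m f x = l"
  using infsumI[OF assms] m_pos[of x] by (simp add: Lap_eq)

lemma Lap_scaleR:
  assumes "in_l2 m f"
  shows "Lap b m (\<lambda>x. c *\<^sub>R f x) = (\<lambda>x. c *\<^sub>R Lap b m f x)"
proof (rule ext, rule Lap_eqI)
  fix x
  show "((\<lambda>y. b x y *\<^sub>R (c *\<^sub>R f x - c *\<^sub>R f y)) has_sum (m x *\<^sub>R (c *\<^sub>R Lap b m f x))) UNIV"
    using has_sum_bounded_linear[OF bounded_linear_scaleR_right Lap_has_sum[OF assms, of x], of c]
    by (simp add: scaleR_diff_right mult.commute)
qed

lemma Lap_add:
  assumes "in_l2 m f" "in_l2 m g"
  shows "Lap b m (\<lambda>x. f x + g x) = (\<lambda>x. Lap b m f x + Lap b m g x)"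
proof (rule ext, rule Lap_eqI)
  fix x
  show "((\<lambda>y. b x y *\<^sub>R (f x + g x - (f y + g y))) has_sum (m x *\<^sub>R (Lap b m f x + Lap b m g x))) UNIV"
    using has_sum_add[OF Lap_has_sum[OF assms(1), of x] Lap_has_sum[OF assms(2), of x]]
    by (simp add: algebra_simps)
qed

lemma Lap_diff:
  assumes "in_l2 m f" "in_l2 m g"
  shows "Lap b m (\<lambda>x. f x - g x) = (\<lambda>x. Lap b m f x - Lap b m g x)"
  using Lap_add[OF assms(1) in_l2_scaleR[OF assms(2), of "-1"]] Lap_scaleR[OF assms(2), of "-1"]
  by simp

lemma Lap_zero: "Lap b m (\<lambda>x. 0) = (\<lambda>x. 0)"
  by (simp add: Lap_def fun_eq_iff)

lemma Lap_sum:
  assumes "\<And>i. i \<in> I \<Longrightarrow> in_l2 m (w i)"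
  shows "Lap b m (\<lambda>x. \<Sum>i\<in>I. w i x) = (\<lambda>x. \<Sum>i\<in>I. Lap b m (w i) x)"
  using assms
  by (induction I rule: infinite_finite_induct) (simp_all add: Lap_zero Lap_add in_l2_sum)

lemma Lap_funpow_in_l2: "in_l2 m f \<Longrightarrow> in_l2 m ((Lap b m ^^ n) f)"
  by (induction n) (auto intro: Lap_in_l2)

lemma l2norm_Lap_funpow_le:
  assumes "in_l2 m f"
  shows "l2norm m ((Lap b m ^^ n) f) \<le> (2 * M) ^ n * l2norm m f"
proof (induction n)
  case (Suc n)
  have "l2norm m ((Lap b m ^^ Suc n) f) \<le> 2 * M * l2norm m ((Lap b m ^^ n) f)"
    using l2norm_Lap_le[OF Lap_funpow_in_l2[OF assms]] by simp
  also have "\<dots> \<le> 2 * M * ((2 * M) ^ n * l2norm m f)"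
    using Suc M_nonneg by (intro mult_left_mono) auto
  finally show ?case
    by simp
qed simp

text \<open>Symmetry moves all powers of the Laplacian to one side, so only moments of the total
  order matter.\<close>

lemma ip_Lap_funpow:
  assumes "in_l2 m f" "in_l2 m g"
  shows "ip ((Lap b m ^^ j) f) ((Lap b m ^^ k) g) = ip ((Lap b m ^^ (j + k)) f) g"
  using assms
proof (induction k arbitrary: g)
  case (Suc k)
  have "ip ((Lap b m ^^ j) f) ((Lap b m ^^ Suc k) g) = ip ((Lap b m ^^ (j + k)) f) (Lap b m g)"
    using Suc.IH[OF Suc.prems(1) Lap_in_l2[OF Suc.prems(2)]] by (simp add: funpow_swap1)
  then show ?case
    using Suc.prems by (simp add: Lap_symmetric Lap_funpow_in_l2)
qed simp

section \<open>The exponential series of the heat flow\<close>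

abbreviation heat_term :: "real \<Rightarrow> ('a \<Rightarrow> complex) \<Rightarrow> nat \<Rightarrow> 'a \<Rightarrow> complex" where
  "heat_term t f n \<equiv> (\<lambda>x. ((- t) ^ n / fact n) *\<^sub>R (Lap b m ^^ n) f x)"

abbreviation heat_bound :: "real \<Rightarrow> ('a \<Rightarrow> complex) \<Rightarrow> nat \<Rightarrow> real" where
  "heat_bound t f n \<equiv> ((\<bar>t\<bar> * (2 * M)) ^ n /\<^sub>R fact n) * l2norm m f"

lemma heat_eq_suminf: "heat b m t f = (\<lambda>x. \<Sum>n. heat_term t f n x)"
  unfolding heat_def scaleR_conv_of_real ..

lemma heat_term_in_l2: "in_l2 m f \<Longrightarrow> in_l2 m (heat_term t f n)"
  by (intro in_l2_scaleR Lap_funpow_in_l2)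

lemma heat_term_le:
  assumes "in_l2 m f"
  shows "l2norm m (heat_term t f n) \<le> heat_bound t f n"
  using mult_left_mono[OF l2norm_Lap_funpow_le[OF assms, of n], of "\<bar>t\<bar> ^ n / fact n"]
  unfolding l2norm_scaleR by (simp add: power_abs abs_mult power_mult_distrib field_simps)

lemma heat_bound_summable: "summable (heat_bound t f)"
  by (intro summable_mult2 summable_exp_generic)

lemmas heat_series = heat_term_in_l2 heat_term_le heat_bound_summable

lemma heat_in_l2: "in_l2 m f \<Longrightarrow> in_l2 m (heat b m t f)"
  unfolding heat_eq_suminf by (rule series_in_l2[OF heat_series])

lemma heat_zero: "heat b m 0 f = f"
proof
  fix x
  have "(\<lambda>n. heat_term 0 f n x) sums (\<Sum>n\<in>{0}. heat_term 0 f n x)"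
    by (rule sums_finite) auto
  then show "heat b m 0 f x = f x"
    by (simp add: heat_eq_suminf sums_iff)
qed

text \<open>At a fixed vertex the flow is an everywhere convergent power series in time. The
  continuity serves for the measurability of the observed norm.\<close>

lemma heat_pointwise_continuous:
  assumes f: "in_l2 m f"
  shows "continuous_on UNIV (\<lambda>t. heat b m t f x)"
proof -
  let ?c = "\<lambda>n. (1 / fact n) *\<^sub>R (Lap b m ^^ n) f x"
  have "isCont (\<lambda>s. \<Sum>n. ?c n * s ^ n) s" for s :: complex
  proof (rule isCont_powser)
    \<comment> \<open>The heat series at time \<open>- (norm s + 1)\<close> has positive powers of
      \<open>norm s + 1\<close>, a radius strictly larger than \<open>norm s\<close>.\<close>
    have "summable (\<lambda>n. heat_term (- (norm s + 1)) f n x)"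
      by (rule series_summable[OF heat_series, OF f f])
    then show "summable (\<lambda>n. ?c n * (of_real (norm s + 1)) ^ n)"
      by (simp add: scaleR_conv_of_real mult_ac add.commute del: of_real_add flip: of_real_power)
  qed simp
  then have "continuous_on UNIV (\<lambda>s::complex. \<Sum>n. ?c n * s ^ n)"
    by (simp add: continuous_at_imp_continuous_on)
  then have "continuous_on UNIV (\<lambda>t::real. \<Sum>n. ?c n * (of_real (- t)) ^ n)"
    by (rule continuous_on_compose2) (auto intro!: continuous_intros)
  then show ?thesis
    by (simp add: heat_eq_suminf scaleR_conv_of_real mult_ac del: of_real_minus flip: of_real_power)
qed

text \<open>The Laplacian acts term by term on partial sums. The remainder is small in norm, the
  Laplacian is bounded, and norm convergence implies convergence at \<open>x\<close>.\<close>

lemma Lap_heat: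
  assumes f: "in_l2 m f"
  shows "Lap b m (heat b m t f) = heat b m t (Lap b m f)"
proof
  fix x
  let ?w = "heat_term t f" and ?S = "heat b m t f"
  have w: "in_l2 m (?w n)" for n
    using f by (rule heat_term_in_l2)
  have S: "in_l2 m ?S"
    using f by (rule heat_in_l2)
  have "(\<lambda>k. Lap b m ?S x - (\<Sum>n<k. Lap b m (?w n) x)) \<longlonglongrightarrow> 0"
  proof (rule Lim_null_comparison)
    show "\<forall>\<^sub>F k in sequentially. norm (Lap b m ?S x - (\<Sum>n<k. Lap b m (?w n) x))
        \<le> 2 * M * l2norm m (\<lambda>x. ?S x - (\<Sum>n<k. ?w n x)) / sqrt (m x)"
    proof (intro always_eventually allI)
      fix k
      let ?d = "\<lambda>x. ?S x - (\<Sum>n<k. ?w n x)"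
      have d: "in_l2 m ?d"
        by (intro in_l2_diff S in_l2_sum w)
      have "Lap b m ?S x - (\<Sum>n<k. Lap b m (?w n) x) = Lap b m ?d x"
        by (simp only: Lap_diff[OF S in_l2_sum[OF w]] Lap_sum[OF w])
      moreover have "norm (Lap b m ?d x) * sqrt (m x) \<le> 2 * M * l2norm m ?d"
        using l2norm_pointwise[OF Lap_in_l2[OF d]] l2norm_Lap_le[OF d] by (rule order_trans)
      ultimately show "norm (Lap b m ?S x - (\<Sum>n<k. Lap b m (?w n) x)) \<le> 2 * M * l2norm m ?d / sqrt (m x)"
        using m_pos[of x] by (simp add: field_simps)
    qed
    have "(\<lambda>k. l2norm m (\<lambda>x. ?S x - (\<Sum>n<k. ?w n x))) \<longlonglongrightarrow> 0"
      using series_tail_tendsto[OF heat_series, OF f f] by (simp only: heat_eq_suminf)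
    from tendsto_divide[OF tendsto_mult_left[OF this] tendsto_const, of "sqrt (m x)" "2 * M"]
    show "(\<lambda>k. 2 * M * l2norm m (\<lambda>x. ?S x - (\<Sum>n<k. ?w n x)) / sqrt (m x)) \<longlonglongrightarrow> 0"
      using m_pos[of x] by simp
  qed
  then have "(\<lambda>k. \<Sum>n<k. Lap b m (?w n) x) \<longlonglongrightarrow> Lap b m ?S x"
    using tendsto_diff[OF tendsto_const[of "Lap b m ?S x"]] by fastforce
  moreover have "Lap b m (?w n) x = heat_term t (Lap b m f) n x" for n
    by (simp add: Lap_scaleR Lap_funpow_in_l2 f funpow_swap1)
  ultimately show "Lap b m ?S x = heat b m t (Lap b m f) x"
    unfolding heat_eq_suminf by (simp add: sums_def[symmetric] sums_iff)
qed

text \<open>Provides the geometric growth, with ratio \<open>2 * M\<close>, that the exponential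
  moment series require.\<close>

lemma moment_le:
  assumes "in_l2 m u" "in_l2 m v"
  shows "\<bar>ip ((Lap b m ^^ n) u) v\<bar> \<le> (l2norm m u * l2norm m v) * (2 * M) ^ n"
proof -
  have "\<bar>ip ((Lap b m ^^ n) u) v\<bar> \<le> l2norm m ((Lap b m ^^ n) u) * l2norm m v"
    using assms by (intro abs_ip_le Lap_funpow_in_l2)
  also have "\<dots> \<le> ((2 * M) ^ n * l2norm m u) * l2norm m v"
    using assms by (intro mult_right_mono l2norm_Lap_funpow_le l2norm_nonneg)
  finally show ?thesis
    by (simp add: mult_ac)
qed

lemma ip_heat_left:
  assumes "in_l2 m u" "in_l2 m v"
  shows "ip (heat b m t u) v = (\<Sum>n. (- t) ^ n / fact n * ip ((Lap b m ^^ n) u) v)"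
  using series_ip_sums[OF heat_series, OF assms(1,1,2)]
  unfolding heat_eq_suminf by (simp add: ip_scaleR_left sums_iff)

text \<open>The semigroup law \<open>\<langle>S\<^sub>t u, S\<^sub>t v\<rangle> = \<langle>S\<^sub>2\<^sub>t u, v\<rangle>\<close>, in terms of the moments \<open>\<langle>H\<^sup>n u, v\<rangle>\<close>.\<close>

lemma ip_heat_heat:
  assumes u: "in_l2 m u" and v: "in_l2 m v"
  shows "ip (heat b m t u) (heat b m t v) = (\<Sum>n. (- 2 * t) ^ n / fact n * ip ((Lap b m ^^ n) u) v)"
proof -
  have "ip ((Lap b m ^^ j) u) (heat b m t v)
      = (\<Sum>k. (- t) ^ k / fact k * ip ((Lap b m ^^ (j + k)) u) v)" for j
    using ip_heat_left[OF v Lap_funpow_in_l2[OF u], of t j]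
    by (simp add: ip_commute[of _ "(Lap b m ^^ j) u"] ip_Lap_funpow[OF u v])
  then have "ip (heat b m t u) (heat b m t v)
      = (\<Sum>j. (- t) ^ j / fact j * (\<Sum>k. (- t) ^ k / fact k * ip ((Lap b m ^^ (j + k)) u) v))"
    using u v by (simp add: ip_heat_left heat_in_l2)
  also have "\<dots> = (\<Sum>n. (- t + - t) ^ n / fact n * ip ((Lap b m ^^ n) u) v)"
    using M_nonneg by (intro exp_moment_Cauchy_product[OF moment_le[OF u v]]) simp
  finally show ?thesis
    by simp
qed

text \<open>The product depends on time through \<open>- 2 * t\<close>, hence the factor
  \<open>- 2\<close>; the shift of the moments replaces \<open>u\<close> by
  \<open>Lap b m u\<close>.\<close>

lemma DERIV_ip_heat_heat:
  assumes u: "in_l2 m u" and v: "in_l2 m v"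
  shows "((\<lambda>t. ip (heat b m t u) (heat b m t v)) has_real_derivative
    - 2 * ip (heat b m t (Lap b m u)) (heat b m t v)) (at t)"
proof -
  let ?\<mu> = "\<lambda>n. ip ((Lap b m ^^ n) u) v"
  have "((\<lambda>t. \<Sum>n. (- 2 * t) ^ n / fact n * ?\<mu> n) has_real_derivative
      (\<Sum>n. (- 2 * t) ^ n / fact n * ?\<mu> (Suc n)) * - 2) (at t)"
    by (rule DERIV_chain2[OF DERIV_exp_moment[OF moment_le[OF u v]]]) (auto intro!: derivative_eq_intros)
  moreover have "?\<mu> (Suc n) = ip ((Lap b m ^^ n) (Lap b m u)) v" for n
    by (simp add: funpow_swap1)
  ultimately show ?thesis
    using u v by (simp add: ip_heat_heat Lap_in_l2 mult.commute)
qed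

text \<open>The derivative of the squared norm is minus twice the energy.\<close>

lemma l2norm_heat_antimono:
  assumes f: "in_l2 m f" and "s \<le> t"
  shows "l2norm m (heat b m t f) \<le> l2norm m (heat b m s f)"
proof -
  let ?F = "\<lambda>t. ip (heat b m t f) (heat b m t f)"
  have "?F t \<le> ?F s"
  proof (rule DERIV_nonpos_imp_nonincreasing[OF \<open>s \<le> t\<close>])
    fix x
    have "0 \<le> ip (heat b m x (Lap b m f)) (heat b m x f)"
      using energy_nonneg[of "heat b m x f"] ip_Lap_left[OF heat_in_l2 heat_in_l2, OF f f, of x x]
      by (simp add: Lap_heat[OF f])
    then show "\<exists>y. (?F has_real_derivative y) (at x) \<and> y \<le> 0"
      using DERIV_ip_heat_heat[OF f f, of x] by (intro exI conjI) auto
  qed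
  then show ?thesis
    by (simp add: l2norm_eq_sqrt_ip)
qed

text \<open>
  The function \<open>P(s) = \<parallel>e\<^sup>c\<^sup>s S\<^sub>s f\<parallel>\<^sup>2\<close> is convex, because \<open>P'' = 4 \<parallel>(H - c) e\<^sup>c\<^sup>s S\<^sub>s f\<parallel>\<^sup>2\<close>; the energy
  hypothesis says \<open>P'(t) \<le> 0\<close>, hence \<open>P(t) \<le> P(0)\<close>.
\<close>

lemma heat_decay_of_energy_ge:
  assumes f: "in_l2 m f" and t: "t \<ge> 0"
    and ge: "energy (heat b m t f) (heat b m t f) \<ge> c * ip (heat b m t f) (heat b m t f)"
  shows "l2norm m (heat b m t f) \<le> exp (- c * t) * l2norm m f"
proof -
  let ?S = "\<lambda>s. heat b m s f" and ?H = "Lap b m"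
  define F where "F = (\<lambda>s. ip (?S s) (?S s))"
  define G where "G = (\<lambda>s. ip (?H (?S s)) (?S s))"
  define K where "K = (\<lambda>s. ip (?H (?S s)) (?H (?S s)))"
  define P where "P = (\<lambda>s. exp (2 * c * s) * F s)"
  define P' where "P' = (\<lambda>s. exp (2 * c * s) * (2 * c * F s - 2 * G s))"
  have S: "in_l2 m (?S s)" and HS: "in_l2 m (?H (?S s))" for s
    using f by (auto intro: heat_in_l2 Lap_in_l2)
  have F': "(F has_real_derivative - 2 * G s) (at s)" for s
    unfolding F_def G_def using DERIV_ip_heat_heat[OF f f, of s] by (simp add: Lap_heat f)
  have G': "(G has_real_derivative - 2 * K s) (at s)" for s
  proof -
    \<comment> \<open>Symmetry moves one Laplacian to the other side, so the derivative of
      \<open>G\<close> is \<open>- 2\<close> times a squared norm.\<close>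
    have "ip (heat b m s (?H (?H f))) (heat b m s f) = K s"
      using Lap_symmetric[OF HS S, of s s] unfolding K_def
      by (simp add: Lap_heat f Lap_in_l2)
    then show ?thesis
      unfolding G_def using DERIV_ip_heat_heat[OF Lap_in_l2[OF f] f, of s]
      by (simp add: Lap_heat f)
  qed
  have dP: "(P has_real_derivative P' s) (at s)" for s
    unfolding P_def P'_def
    by (auto intro!: derivative_eq_intros F' simp: algebra_simps)
  have dP': "(P' has_real_derivative
      exp (2 * c * s) * (4 * (K s - 2 * c * G s + c\<^sup>2 * F s))) (at s)" for s
    unfolding P'_def
    by (auto intro!: derivative_eq_intros F' G' simp: algebra_simps power2_eq_square)
  have sq: "K s - 2 * c * G s + c\<^sup>2 * F s \<ge> 0" for s
  proof -
    let ?L = "\<lambda>x. c *\<^sub>R ?S s x"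
    have "0 \<le> ip (\<lambda>x. ?H (?S s) x - ?L x) (\<lambda>x. ?H (?S s) x - ?L x)"
      by (rule ip_self_nonneg)
    also have "\<dots> = K s - 2 * c * G s + c\<^sup>2 * F s"
      using S HS
      by (simp add: ip_diff_left ip_diff_right in_l2_diff in_l2_scaleR ip_scaleR_left ip_scaleR_right
          F_def G_def K_def ip_commute[of "?S s" "?H (?S s)"])
        (simp add: power2_eq_square algebra_simps)
    finally show ?thesis .
  qed
  have "P' t \<le> 0"
    using ge unfolding P'_def F_def G_def by (simp add: ip_Lap_left S mult_le_0_iff)
  have "P' s \<le> 0" if "s \<le> t" for s
  proof -
    have "P' s \<le> P' t"
      using dP' mult_nonneg_nonneg[OF exp_ge_zero mult_nonneg_nonneg[OF _ sq], of 4]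
      by (intro DERIV_nonneg_imp_nondecreasing[OF that]) fastforce
    with \<open>P' t \<le> 0\<close> show ?thesis
      by simp
  qed
  then have "P t \<le> P 0"
    using dP by (intro DERIV_nonpos_imp_nonincreasing[OF t]) blast
  moreover have "P t = (exp (c * t) * l2norm m (?S t))\<^sup>2" "P 0 = (l2norm m f)\<^sup>2"
    by (simp_all add: P_def F_def l2norm_power2 power_mult_distrib heat_zero exp_double mult.assoc)
  ultimately have "exp (c * t) * l2norm m (?S t) \<le> l2norm m f"
    using l2norm_nonneg by (metis power2_le_imp_le)
  then show ?thesis
    by (simp add: exp_minus field_simps)
qed

end

section \<open>Paths, balls and the Poincare inequality\<close>

text \<open>\<open>successively\<close> follows the list structure and so suits induction, splitting
  and reversal better than indices.\<close>

lemma is_path_iff_successively: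
  "is_path b p x y \<longleftrightarrow> p \<noteq> [] \<and> hd p = x \<and> last p = y \<and> successively (\<lambda>u v. b u v > 0) p"
  by (auto simp: is_path_def successively_conv_nth)

lemma path_length_simps [simp]:
  "path_length b [] = 0" "path_length b [x] = 0"
  "path_length b (x # y # p) = 1 / b x y + path_length b (y # p)"
  by (simp_all add: path_length_def sum.lessThan_Suc_shift del: sum.lessThan_Suc)

text \<open>The splitting vertex \<open>y\<close> belongs to both pieces, so that no edge is lost or
  counted twice.\<close>

lemma path_length_append:
  "path_length b (xs @ y # zs) = path_length b (xs @ [y]) + path_length b (y # zs)"
proof (induction xs)
  case (Cons x xs)
  then show ?case
    by (cases xs) simp_all
qed simp

lemma path_length_rev:
  assumes "\<And>u v. b u v = b v u"
  shows "path_length b (rev p) = path_length b p"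
proof (induction p rule: induct_list012)
  case (3 x y p)
  then show ?case
    using path_length_append[of b "rev p" y "[x]"] assms[of x y] by simp
qed simp_all

locale bounded_connected_graph = bounded_graph +
  assumes connected: "connected_graph b" and bounded_measure: "bounded_measure m"
begin

section \<open>The length metric\<close>

lemma path_length_nonneg: "path_length b p \<ge> 0"
  unfolding path_length_def by (intro sum_nonneg) (simp add: b_nonneg)

lemma dL_le_path_length:
  assumes "is_path b p x y"
  shows "dL b x y \<le> path_length b p"
  using assms path_length_nonneg unfolding dL_def by (auto intro!: cInf_lower bdd_belowI)

text \<open>Connectedness makes the set under the infimum nonempty, so the infimum is approached by
  paths; for \<open>x = y\<close> the one-vertex path has length \<open>0\<close>.\<close>

lemma exists_path_less:
  assumes "dL b x y < r"
  obtains p where "is_path b p x y" "path_length b p < r"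
proof (cases "x = y")
  case True
  then have "is_path b [x] x y" "path_length b [x] < r"
    using assms by (auto simp: is_path_def dL_def)
  then show ?thesis ..
next
  case False
  have "{path_length b p | p. is_path b p x y} \<noteq> {}"
    using connected by (auto simp: connected_graph_def)
  then show ?thesis
    using assms False cInf_lessD[of "{path_length b p | p. is_path b p x y}" r] that
    by (auto simp: dL_def)
qed

lemma is_path_rev: "is_path b (rev p) y x \<longleftrightarrow> is_path b p x y"
proof -
  have "(\<lambda>u v. b v u > 0) = (\<lambda>u v. b u v > 0)"
    by (intro ext) (subst b_sym, rule refl)
  then have "successively (\<lambda>u v. b v u > 0) p = successively (\<lambda>u v. b u v > 0) p"
    by (rule arg_cong)
  then show ?thesis
    by (auto simp: is_path_iff_successively hd_rev last_rev)
qed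

text \<open>Reversal preserves length. The \<open>e\<close> is there because the infimum is not
  known to be attained.\<close>

lemma dL_sym: "dL b x y = dL b y x"
proof -
  have "dL b x y \<le> dL b y x" for x y
  proof (rule field_le_epsilon)
    fix e :: real assume "e > 0"
    then obtain p where p: "is_path b p y x" "path_length b p < dL b y x + e"
      using exists_path_less[of y x "dL b y x + e"] by auto
    have "dL b x y \<le> path_length b (rev p)"
      using p by (intro dL_le_path_length) (simp add: is_path_rev)
    with p show "dL b x y \<le> dL b y x + e"
      by (simp add: path_length_rev[of b, OF b_sym])
  qed
  then show ?thesis
    by (simp add: antisym)
qed

section \<open>Uniform bounds for walks and balls\<close>

definition m_bound :: real where "m_bound = (SUP x. m x)"

lemma m_le: "m x \<le> m_bound"
  unfolding m_bound_def using bounded_measure by (intro cSUP_upper) (auto simp: bounded_measure_def)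

text \<open>The summand \<open>1\<close> keeps the constant positive even if there are no edges, so
  one may divide by it.\<close>

definition b_bound :: real where "b_bound = M * m_bound + 1"

lemma b_row_le_bound: "(\<Sum>\<^sub>\<infinity>y. b x y) \<le> b_bound"
  using b_row_le[of x] mult_left_mono[OF m_le[of x] M_nonneg] by (simp add: b_bound_def)

lemma b_bound_pos: "b_bound > 0"
  using mult_nonneg_nonneg[OF M_nonneg order_trans[OF m_nonneg m_le]] by (simp add: b_bound_def add_nonneg_pos)

lemma sum_b_le: "finite A \<Longrightarrow> (\<Sum>y\<in>A. b x y) \<le> b_bound"
  using finite_sum_le_infsum[OF b_summable[of x], of A] b_row_le_bound[of x] by (force simp: b_nonneg)

text \<open>One weight is at most its row sum, and the row sums are bounded uniformly. Short paths
  therefore have few edges.\<close>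

lemma inverse_b_ge: "b x y > 0 \<Longrightarrow> 1 / b x y \<ge> 1 / b_bound"
  using sum_b_le[of "{y}" x] by (simp add: frac_le)

lemma path_length_ge:
  "successively (\<lambda>u v. b u v > 0) p \<Longrightarrow> p \<noteq> [] \<Longrightarrow> (real (length p) - 1) / b_bound \<le> path_length b p"
proof (induction p rule: induct_list012)
  case (3 x y p)
  then show ?case
    using inverse_b_ge[of x y] by (simp add: add_divide_distrib diff_divide_distrib)
qed simp_all

lemma path_edges_ge:
  assumes R: "R > 0"
  shows "successively (\<lambda>u v. b u v > 0) p \<Longrightarrow> path_length b p \<le> R \<Longrightarrow> successively (\<lambda>u v. b u v \<ge> 1 / R) p"
proof (induction p rule: induct_list012)
  case (3 x y p)
  then have "1 / b x y \<le> R" "path_length b (y # p) \<le> R"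
    using path_length_nonneg[of "y # p"] b_nonneg[of x y] by (auto simp: add_nonneg_nonneg intro: order_trans[rotated])
  with 3 R show ?case
    by (simp add: field_simps)
qed simp_all

text \<open>A row of total at most \<open>b_bound\<close> has room for at most
  \<open>R * b_bound\<close> weights of size \<open>1 / R\<close> or more.\<close>

lemma neighbours_bound:
  assumes "R > 0"
  shows "finite {y. b x y \<ge> 1 / R} \<and> card {y. b x y \<ge> 1 / R} \<le> nat \<lfloor>R * b_bound\<rfloor>"
proof (rule finite_if_finite_subsets_card_bdd)
  fix F assume F: "F \<subseteq> {y. b x y \<ge> 1 / R}" "finite F"
  have "real (card F) * (1 / R) \<le> (\<Sum>y\<in>F. b x y)"
    using F by (intro sum_bounded_below) auto
  also have "\<dots> \<le> b_bound"
    using F by (intro sum_b_le)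
  finally show "card F \<le> nat \<lfloor>R * b_bound\<rfloor>"
    using assms by (simp add: le_nat_floor field_simps)
qed

text \<open>First-step decomposition: \<open>n\<close> counts edges, and each step has at most
  \<open>nat \<lfloor>R * b_bound\<rfloor>\<close> choices.\<close>

lemma strong_walks_bound:
  assumes R: "R > 0"
  shows "finite {p. length p = Suc n \<and> hd p = x \<and> successively (\<lambda>u v. b u v \<ge> 1 / R) p} \<and>
    card {p. length p = Suc n \<and> hd p = x \<and> successively (\<lambda>u v. b u v \<ge> 1 / R) p} \<le> nat \<lfloor>R * b_bound\<rfloor> ^ n"
proof (induction n arbitrary: x)
  case 0
  have "{p. length p = Suc 0 \<and> hd p = x \<and> successively (\<lambda>u v. b u v \<ge> 1 / R) p} = {[x]}"
    by (auto simp: length_Suc_conv)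
  then show ?case
    by simp
next
  case (Suc n)
  let ?W = "\<lambda>n x. {p. length p = Suc n \<and> hd p = x \<and> successively (\<lambda>u v. b u v \<ge> 1 / R) p}"
  let ?N = "{y. b x y \<ge> 1 / R}" and ?k = "nat \<lfloor>R * b_bound\<rfloor>"
  have sub: "?W (Suc n) x \<subseteq> (\<Union>y\<in>?N. (#) x ` ?W n y)"
    by (auto simp: length_Suc_conv image_iff)
  have fin: "finite (\<Union>y\<in>?N. (#) x ` ?W n y)"
    using Suc neighbours_bound[OF R, of x] by blast
  have "card (\<Union>y\<in>?N. (#) x ` ?W n y) \<le> (\<Sum>y\<in>?N. card ((#) x ` ?W n y))"
    using neighbours_bound[OF R, of x] by (intro card_UN_le) auto
  also have "\<dots> \<le> of_nat (card ?N) * ?k ^ n"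
    using Suc by (intro sum_bounded_above) (auto intro!: order_trans[OF card_image_le])
  also have "\<dots> \<le> ?k * ?k ^ n"
    using neighbours_bound[OF R, of x] by (intro mult_right_mono) auto
  finally show ?case
    using sub fin card_mono[OF fin sub] by (auto intro: finite_subset)
qed

definition short_walks :: "real \<Rightarrow> 'a \<Rightarrow> 'a list set" where
  "short_walks R x = {p. p \<noteq> [] \<and> hd p = x \<and> successively (\<lambda>u v. b u v > 0) p \<and> path_length b p \<le> R}"

text \<open>On a walk of length at most \<open>R\<close> every edge has weight at least
  \<open>1 / R\<close>, and there are at most \<open>R * b_bound\<close> edges. The count is uniform
  in the starting vertex, as the supremum in \<open>vol\<close> requires.\<close>

lemma short_walks_bound:
  assumes R: "R > 0"
  obtains N where "\<And>x. finite (short_walks R x)" "\<And>x. card (short_walks R x) \<le> N"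
proof -
  define k where "k = nat \<lfloor>R * b_bound\<rfloor>"
  let ?W = "\<lambda>n x. {p. length p = Suc n \<and> hd p = x \<and> successively (\<lambda>u v. b u v \<ge> 1 / R) p}"
  have sub: "short_walks R x \<subseteq> (\<Union>n\<in>{..k}. ?W n x)" for x
  proof
    fix p assume p: "p \<in> short_walks R x"
    then have "(real (length p) - 1) / b_bound \<le> R"
      using path_length_ge[of p] by (auto simp: short_walks_def)
    then have "length p - 1 \<le> k"
      using b_bound_pos p unfolding k_def by (intro le_nat_floor) (auto simp: short_walks_def field_simps of_nat_diff Suc_leI)
    with p path_edges_ge[OF R, of p] show "p \<in> (\<Union>n\<in>{..k}. ?W n x)"
      by (auto simp: short_walks_def intro!: bexI[of _ "length p - 1"])
  qed
  have fin: "finite (\<Union>n\<in>{..k}. ?W n x)" for x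
    using strong_walks_bound[OF R] by blast
  have "card (short_walks R x) \<le> (\<Sum>n\<le>k. k ^ n)" for x
  proof -
    have "card (short_walks R x) \<le> card (\<Union>n\<in>{..k}. ?W n x)"
      by (intro card_mono fin sub)
    also have "\<dots> \<le> (\<Sum>n\<le>k. card (?W n x))"
      by (intro card_UN_le) simp
    also have "\<dots> \<le> (\<Sum>n\<le>k. k ^ n)"
      using strong_walks_bound[OF R] unfolding k_def by (intro sum_mono) blast
    finally show ?thesis .
  qed
  then show ?thesis
    using that finite_subset[OF sub fin] by blast
qed

lemma closed_ball_bound:
  obtains N where "\<And>x. finite (closed_ball (dL b) r x)" "\<And>x. card (closed_ball (dL b) r x) \<le> N"
proof -
  \<comment> \<open>Positive and strictly above \<open>r\<close>, so that
    \<open>dL b x y \<le> r\<close> yields an actual path of length below \<open>R\<close>.\<close>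
  define R where "R = max r 0 + 1"
  have "R > 0"
    by (simp add: R_def)
  then obtain N where N: "\<And>x. finite (short_walks R x)" "\<And>x. card (short_walks R x) \<le> N"
    using short_walks_bound by blast
  have sub: "closed_ball (dL b) r x \<subseteq> last ` short_walks R x" for x
  proof
    fix y assume "y \<in> closed_ball (dL b) r x"
    then have "dL b x y < R"
      by (simp add: closed_ball_def R_def)
    then obtain p where "is_path b p x y" "path_length b p < R"
      by (rule exists_path_less)
    then show "y \<in> last ` short_walks R x"
      by (auto simp: short_walks_def is_path_iff_successively)
  qed
  have "card (closed_ball (dL b) r x) \<le> N" for x
    using card_mono[OF finite_imageI[OF N(1)] sub, of x] card_image_le[OF N(1), of last x] N(2)[of x] by simp
  then show ?thesis
    using that finite_subset[OF sub finite_imageI[OF N(1)]] by blast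
qed

lemma finite_closed_ball: "finite (closed_ball (dL b) r x)"
  using closed_ball_bound by blast

text \<open>A real supremum is sure to dominate its members only for a bounded family; the uniform
  ball size times \<open>m_bound\<close> is such a bound.\<close>

lemma meas_closed_ball_le_vol: "meas m (closed_ball (dL b) r x) \<le> vol (dL b) m r"
  unfolding vol_def
proof (rule cSUP_upper)
  obtain N where N: "\<And>x. card (closed_ball (dL b) r x) \<le> N"
    using closed_ball_bound by blast
  have "meas m (closed_ball (dL b) r x) \<le> real N * m_bound" for x
  proof -
    have "meas m (closed_ball (dL b) r x) \<le> real (card (closed_ball (dL b) r x)) * m_bound"
      unfolding meas_def infsum_finite[OF finite_closed_ball] by (intro sum_bounded_above m_le)
    also have "\<dots> \<le> real N * m_bound"
      using N order_trans[OF m_nonneg m_le] by (intro mult_right_mono) auto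
    finally show ?thesis .
  qed
  then show "bdd_above (range (\<lambda>x. meas m (closed_ball (dL b) r x)))"
    by (intro bdd_aboveI[of _ "real N * m_bound"]) auto
qed simp

text \<open>A ball contains its centre; \<open>undefined\<close> stands for an arbitrary
  vertex.\<close>

lemma vol_pos:
  assumes "r \<ge> 0"
  shows "vol (dL b) m r > 0"
proof -
  have "undefined \<in> closed_ball (dL b) r undefined"
    using assms by (simp add: closed_ball_def dL_def)
  have "0 < m undefined"
    by (rule m_pos)
  also have "\<dots> \<le> meas m (closed_ball (dL b) r undefined)"
    unfolding meas_def infsum_finite[OF finite_closed_ball]
    by (rule member_le_sum[OF \<open>undefined \<in> _\<close>]) (simp_all add: finite_closed_ball m_nonneg)
  also have "\<dots> \<le> vol (dL b) m r"
    by (rule meas_closed_ball_le_vol)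
  finally show ?thesis .
qed

end

section \<open>Inradius and paths to the observed set\<close>

locale observation_graph = bounded_connected_graph +
  fixes D :: "'a set"
  assumes D_proper: "D \<subset> UNIV" and D_dense: "rel_dense (dL b) D"
begin

abbreviation \<rho> :: real where "\<rho> \<equiv> inradius (dL b) (UNIV - D)"

text \<open>Relative density puts a point of \<open>D\<close> within some fixed \<open>R\<close> of
  every vertex, so no admissible radius exceeds \<open>R\<close> and the supremum is
  meaningful.\<close>

lemma le_inradius:
  assumes "r > 0" "x \<notin> D" "open_ball (dL b) r x \<subseteq> UNIV - D"
  shows "r \<le> \<rho>"
  unfolding inradius_def
proof (rule cSup_upper)
  obtain R where R: "(\<Union>x\<in>D. closed_ball (dL b) R x) = UNIV"
    using D_dense by (auto simp: rel_dense_def)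
  show "bdd_above {r. r > 0 \<and> (\<exists>x\<in>UNIV - D. open_ball (dL b) r x \<subseteq> UNIV - D)}"
  proof (rule bdd_aboveI, clarify)
    fix r x assume r: "open_ball (dL b) r x \<subseteq> UNIV - D"
    obtain y where "y \<in> D" "dL b y x \<le> R"
      using R by (auto simp: closed_ball_def)
    with r show "r \<le> R"
      using dL_sym[of x y] by (force simp: open_ball_def)
  qed
qed (use assms in auto)

text \<open>Take a shortest path from \<open>x\<close> to \<open>D\<close>. No point of
  \<open>D\<close> is nearer than its length, so the open ball of that radius avoids
  \<open>D\<close> and the length is an admissible radius.\<close>

lemma exists_path_to_D:
  assumes x: "x \<notin> D"
  obtains p y where "is_path b p x y" "y \<in> D" "path_length b p \<le> \<rho>" "path_length b p > 0"
proof -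
  obtain z where z: "z \<in> D"
    using D_dense by (auto simp: rel_dense_def)
  obtain q where q: "is_path b q x z"
    using connected by (auto simp: connected_graph_def)
  \<comment> \<open>Length of some path to \<open>D\<close>, plus \<open>1\<close> for positivity:
    the walks to \<open>D\<close> of length up to \<open>R\<close> form a finite set containing
    \<open>q\<close>, so a minimum exists.\<close>
  define R where "R = path_length b q + 1"
  define P where "P = {p \<in> short_walks R x. last p \<in> D}"
  have "R > 0"
    using path_length_nonneg[of q] by (simp add: R_def)
  then have "finite P"
    using short_walks_bound[of R] finite_subset[of P "short_walks R x"] unfolding P_def by blast
  moreover have "q \<in> P"
    using q z by (auto simp: P_def short_walks_def is_path_iff_successively R_def)
  ultimately obtain p where p: "p \<in> P" and min: "\<And>p'. p' \<in> P \<Longrightarrow> path_length b p \<le> path_length b p'"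
    using that[of "arg_min_on (path_length b) P"] arg_min_if_finite(1)[of P "path_length b"]
      arg_min_least[of P _ "path_length b"] by blast
  have path: "is_path b p x (last p)" "last p \<in> D"
    using p by (auto simp: P_def short_walks_def is_path_iff_successively)
  \<comment> \<open>\<open>x \<notin> D\<close> excludes the one-vertex path, so at least one edge
    contributes to the length.\<close>
  have "length p \<noteq> 1"
    using path x by (auto simp: is_path_def length_Suc_conv)
  then have "0 < (real (length p) - 1) / b_bound"
    using b_bound_pos path by (cases p) (auto simp: is_path_def)
  also have "\<dots> \<le> path_length b p"
    using path by (intro path_length_ge) (auto simp: is_path_iff_successively)
  finally have pos: "path_length b p > 0" .
  have "open_ball (dL b) (path_length b p) x \<subseteq> UNIV - D"
  proof (clarsimp simp: open_ball_def)
    fix y assume y: "y \<in> D" "dL b x y < path_length b p"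
    from exists_path_less[OF y(2)]
    obtain p' where p': "is_path b p' x y" "path_length b p' < path_length b p" .
    moreover have "path_length b p \<le> R"
      using p by (simp add: P_def short_walks_def)
    ultimately have "p' \<in> P"
      using y by (auto simp: P_def short_walks_def is_path_iff_successively)
    with min p' show False
      by fastforce
  qed
  then have "path_length b p \<le> \<rho>"
    using pos x by (intro le_inradius)
  with path pos show ?thesis
    using that by blast
qed

lemma inradius_pos: "\<rho> > 0"
proof -
  obtain x where "x \<notin> D"
    using D_proper by auto
  then show ?thesis
    by (rule exists_path_to_D) linarith
qed

text \<open>Minimise the number of vertices: cutting out a loop does not increase the length.
  Distinctness ensures later that no edge is traversed twice, in either direction.\<close>

lemma exists_simple_path_to_D:
  assumes x: "x \<notin> D"
  obtains p y where "is_path b p x y" "y \<in> D" "path_length b p \<le> \<rho>" "distinct p"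
proof -
  let ?P = "\<lambda>p. is_path b p x (last p) \<and> last p \<in> D \<and> path_length b p \<le> \<rho>"
  obtain p0 where "?P p0"
    by (rule exists_path_to_D[OF x]) (auto simp: is_path_def)
  then obtain p where p: "?P p" and min: "\<And>q. ?P q \<Longrightarrow> length p \<le> length q"
    using ex_has_least_nat[of ?P p0 length] by blast
  have "distinct p"
  proof (rule ccontr)
    assume "\<not> distinct p"
    then obtain xs ys zs y where eq: "p = xs @ [y] @ ys @ [y] @ zs"
      using not_distinct_decomp by blast
    let ?q = "xs @ y # zs"
    have "path_length b p = path_length b (xs @ [y]) + path_length b (y # ys @ [y]) + path_length b (y # zs)"
      using path_length_append[of b xs y "ys @ y # zs"] path_length_append[of b "y # ys" y zs]
      by (simp add: eq)
    then have "path_length b ?q \<le> path_length b p"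
      using path_length_append[of b xs y zs] path_length_nonneg[of "y # ys @ [y]"] by simp
    moreover have "is_path b ?q x (last ?q)" "last ?q = last p"
      using p unfolding eq by (auto simp: is_path_iff_successively successively_append_iff successively_Cons hd_append)
    ultimately have "?P ?q"
      using p by simp
    from min[OF this] show False
      by (simp add: eq)
  qed
  with p show ?thesis
    using that by blast
qed

text \<open>Reversing the initial segment up to \<open>u\<close> gives a path from \<open>u\<close>
  to \<open>x\<close>. This places \<open>x\<close> in a ball around \<open>u\<close>, the form
  needed when counting the paths through an edge at \<open>u\<close>.\<close>

lemma dL_le_of_mem_path:
  assumes p: "is_path b p x y" and u: "u \<in> set p"
  shows "dL b u x \<le> path_length b p"
proof -
  obtain xs zs where eq: "p = xs @ u # zs"
    using u by (auto dest: split_list)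
  have "is_path b (rev (xs @ [u])) u x"
    unfolding is_path_rev using p unfolding eq
    by (cases xs) (auto simp: is_path_iff_successively successively_append_iff successively_Cons hd_append)
  then have "dL b u x \<le> path_length b (rev (xs @ [u]))"
    by (rule dL_le_path_length)
  also have "\<dots> \<le> path_length b p"
    using path_length_append[of b xs u zs] path_length_nonneg[of "u # zs"]
      path_length_rev[of b "xs @ [u]", OF b_sym] by (simp add: eq)
  finally show ?thesis .
qed

section \<open>The Poincare inequality\<close>

lemma path_Cauchy_Schwarz:
  fixes f :: "'a \<Rightarrow> complex"
  assumes p: "is_path b p x y"
  shows "(norm (f x - f y))\<^sup>2
    \<le> path_length b p * (\<Sum>j<length p - 1. b (p ! j) (p ! Suc j) * (norm (f (p ! j) - f (p ! Suc j)))\<^sup>2)"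
proof -
  let ?n = "length p - 1" and ?b = "\<lambda>j. b (p ! j) (p ! Suc j)" and ?d = "\<lambda>j. f (p ! j) - f (p ! Suc j)"
  have pos: "?b j > 0" if "j < ?n" for j
    using p that by (simp add: is_path_def)
  have "f x - f y = f (p ! 0) - f (p ! ?n)"
    using p by (auto simp: is_path_def hd_conv_nth last_conv_nth)
  also have "\<dots> = (\<Sum>j<?n. ?d j)"
    by (rule sum_lessThan_telescope'[symmetric])
  finally have "norm (f x - f y) \<le> (\<Sum>j<?n. norm (?d j))"
    by (simp add: norm_sum)
  \<comment> \<open>With this splitting of the factor \<open>1\<close>, the first factor of
    Cauchy-Schwarz becomes the path length.\<close>
  also have "\<dots> = (\<Sum>j<?n. (1 / sqrt (?b j)) * (sqrt (?b j) * norm (?d j)))"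
    using pos by (intro sum.cong) (auto simp: less_imp_neq[symmetric])
  finally have "(norm (f x - f y))\<^sup>2 \<le> (\<Sum>j<?n. (1 / sqrt (?b j)) * (sqrt (?b j) * norm (?d j)))\<^sup>2"
    by (rule power_mono) simp
  also have "\<dots> \<le> (\<Sum>j<?n. (1 / sqrt (?b j))\<^sup>2) * (\<Sum>j<?n. (sqrt (?b j) * norm (?d j))\<^sup>2)"
    by (rule Cauchy_Schwarz_ineq_sum)
  also have "\<dots> = path_length b p * (\<Sum>j<?n. ?b j * (norm (?d j))\<^sup>2)"
    unfolding path_length_def
    by (simp add: power_divide power_mult_distrib b_nonneg)
  finally show ?thesis .
qed

text \<open>\<open>E\<close> holds the edges of a simple path from \<open>x\<close> to
  \<open>D\<close> in both orientations, to match the energy sum over ordered pairs; hence the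
  factor \<open>2\<close>.\<close>

lemma exists_edge_set:
  fixes f :: "'a \<Rightarrow> complex"
  assumes f: "\<And>y. y \<in> D \<Longrightarrow> f y = 0" and x: "x \<notin> D"
  shows "\<exists>E. finite E \<and> (\<forall>(u, v)\<in>E. dL b u x \<le> \<rho>) \<and>
    2 * (norm (f x))\<^sup>2 \<le> \<rho> * (\<Sum>(u, v)\<in>E. b u v * (norm (f u - f v))\<^sup>2)"
proof -
  obtain p y where p: "is_path b p x y" "y \<in> D" "path_length b p \<le> \<rho>" "distinct p"
    using exists_simple_path_to_D[OF x] by blast
  define n where "n = length p - 1"
  define e where "e = (\<lambda>j. (p ! j, p ! Suc j))"
  let ?E1 = "e ` {..<n}" and ?E2 = "prod.swap ` e ` {..<n}"
  have ne: "p \<noteq> []"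
    using p by (simp add: is_path_def)
  have inj: "inj_on e {..<n}"
    using p(4) by (auto simp: inj_on_def e_def n_def nth_eq_iff_index_eq)
  \<comment> \<open>Two steps of the path that reverse each other would revisit a vertex.\<close>
  have disj: "?E1 \<inter> ?E2 = {}"
    using p(4) by (auto simp: e_def n_def nth_eq_iff_index_eq)
  have near: "\<forall>(u, v)\<in>?E1 \<union> ?E2. dL b u x \<le> \<rho>"
  proof clarify
    fix u v assume "(u, v) \<in> ?E1 \<union> ?E2"
    then have "u \<in> set p"
      using ne by (auto simp: e_def n_def)
    from dL_le_of_mem_path[OF p(1) this] p(3) show "dL b u x \<le> \<rho>"
      by (rule order_trans)
  qed
  have "2 * (norm (f x))\<^sup>2 \<le> \<rho> * (\<Sum>(u, v)\<in>?E1 \<union> ?E2. b u v * (norm (f u - f v))\<^sup>2)"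
  proof -
    let ?w = "\<lambda>(u, v). b u v * (norm (f u - f v))\<^sup>2"
    have w_swap: "?w (prod.swap q) = ?w q" for q
      by (cases q) (simp add: b_sym norm_minus_commute)
    have "sum ?w ?E2 = (\<Sum>q\<in>?E1. ?w (prod.swap q))"
      by (subst sum.reindex) (auto simp: o_def)
    then have "sum ?w ?E2 = sum ?w ?E1"
      by (simp only: w_swap)
    then have "sum ?w (?E1 \<union> ?E2) = 2 * sum ?w ?E1"
      using disj by (subst sum.union_disjoint) auto
    also have "sum ?w ?E1 = (\<Sum>j<n. b (p ! j) (p ! Suc j) * (norm (f (p ! j) - f (p ! Suc j)))\<^sup>2)"
      unfolding sum.reindex[OF inj] by (simp add: e_def)
    finally have W: "sum ?w (?E1 \<union> ?E2)
        = 2 * (\<Sum>j<n. b (p ! j) (p ! Suc j) * (norm (f (p ! j) - f (p ! Suc j)))\<^sup>2)" .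
    have "(norm (f x))\<^sup>2 \<le> path_length b p * (\<Sum>j<n. b (p ! j) (p ! Suc j) * (norm (f (p ! j) - f (p ! Suc j)))\<^sup>2)"
      using path_Cauchy_Schwarz[OF p(1), of f] p(2) f by (simp add: n_def)
    also have "\<dots> \<le> \<rho> * (\<Sum>j<n. b (p ! j) (p ! Suc j) * (norm (f (p ! j) - f (p ! Suc j)))\<^sup>2)"
      using p(3) by (intro mult_right_mono sum_nonneg) (auto simp: b_nonneg)
    finally show ?thesis
      unfolding W by simp
  qed
  with near show ?thesis
    by (intro exI[of _ "?E1 \<union> ?E2"]) simp
qed

text \<open>Sum the path estimates against \<open>m\<close> and exchange summations: an ordered edge
  \<open>(u, v)\<close> serves only vertices \<open>x\<close> in the ball of radius
  \<open>\<rho>\<close> around \<open>u\<close>, whose measure is at most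
  \<open>vol (dL b) m \<rho>\<close>.\<close>

lemma Poincare_inequality:
  assumes f: "in_l2 m f" and zero: "\<And>x. x \<in> D \<Longrightarrow> f x = 0"
  shows "ip f f \<le> \<rho> * vol (dL b) m \<rho> * energy f f"
proof -
  let ?V = "vol (dL b) m \<rho>"
  let ?w = "\<lambda>(u, v). b u v * (norm (f u - f v))\<^sup>2"
  have w_nonneg: "?w e \<ge> 0" for e
    by (cases e) (simp add: b_nonneg)
  have w_sum: "?w summable_on UNIV" and w_infsum: "infsum ?w UNIV = 2 * energy f f"
    using energy_summable[OF f] by (simp_all add: energy_def power2_norm_eq_inner)
  obtain E where fin: "\<And>x. x \<notin> D \<Longrightarrow> finite (E x)"
    and near: "\<And>x u v. x \<notin> D \<Longrightarrow> (u, v) \<in> E x \<Longrightarrow> dL b u x \<le> \<rho>"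
    and E: "\<And>x. x \<notin> D \<Longrightarrow> 2 * (norm (f x))\<^sup>2 \<le> \<rho> * sum ?w (E x)"
  proof -
    have "\<forall>x\<in>-D. \<exists>E. finite E \<and> (\<forall>(u, v)\<in>E. dL b u x \<le> \<rho>) \<and> 2 * (norm (f x))\<^sup>2 \<le> \<rho> * sum ?w E"
      using exists_edge_set[of f, OF zero] by simp
    from bchoice[OF this] obtain E where "\<forall>x\<in>-D. finite (E x) \<and> (\<forall>(u, v)\<in>E x. dL b u x \<le> \<rho>)
        \<and> 2 * (norm (f x))\<^sup>2 \<le> \<rho> * sum ?w (E x)" ..
    then show ?thesis
      using that[of E] by fast
  qed
  have "(\<Sum>x\<in>A. m x * (f x \<bullet> f x)) \<le> \<rho> * ?V * energy f f" if "finite A" for A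
  proof -
    define A' where "A' = A - D"
    have A': "finite A'" "\<And>x. x \<in> A' \<Longrightarrow> x \<notin> D"
      using that by (auto simp: A'_def)
    \<comment> \<open>The finite union gives a common index set for the exchange of
      summations.\<close>
    define U where "U = (\<Union>x\<in>A'. E x)"
    have U: "finite U"
      using A' fin by (auto simp: U_def)
    have "2 * (\<Sum>x\<in>A. m x * (f x \<bullet> f x)) = (\<Sum>x\<in>A'. m x * (2 * (norm (f x))\<^sup>2))"
      unfolding sum_distrib_left A'_def using that zero
      by (intro sum.mono_neutral_cong_right) (auto simp: power2_norm_eq_inner)
    also have "\<dots> \<le> (\<Sum>x\<in>A'. m x * (\<rho> * sum ?w (E x)))"
      using A' by (intro sum_mono mult_left_mono E m_nonneg)
    also have "\<dots> = \<rho> * (\<Sum>x\<in>A'. \<Sum>e | e \<in> U \<and> e \<in> E x. m x * ?w e)"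
    proof -
      have "{e. e \<in> U \<and> e \<in> E x} = E x" if "x \<in> A'" for x
        using that by (auto simp: U_def)
      then show ?thesis
        by (simp add: sum_distrib_left mult_ac)
    qed
    also have "(\<Sum>x\<in>A'. \<Sum>e | e \<in> U \<and> e \<in> E x. m x * ?w e) = (\<Sum>e\<in>U. \<Sum>x | x \<in> A' \<and> e \<in> E x. m x * ?w e)"
      using A' U by (intro sum.swap_restrict)
    also have "\<dots> \<le> (\<Sum>e\<in>U. ?V * ?w e)"
    proof (intro sum_mono)
      fix e assume "e \<in> U"
      obtain u v where e: "e = (u, v)"
        by (cases e)
      have "(\<Sum>x | x \<in> A' \<and> e \<in> E x. m x) \<le> (\<Sum>x\<in>closed_ball (dL b) \<rho> u. m x)"
        using A' near by (intro sum_mono2 finite_closed_ball m_nonneg) (auto simp: closed_ball_def e)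
      also have "\<dots> \<le> ?V"
        using meas_closed_ball_le_vol[of \<rho> u] by (simp add: meas_def finite_closed_ball)
      finally show "(\<Sum>x | x \<in> A' \<and> e \<in> E x. m x * ?w e) \<le> ?V * ?w e"
        using w_nonneg[of e] by (simp add: mult_right_mono flip: sum_distrib_right)
    qed
    also have "\<dots> = ?V * sum ?w U"
      by (simp add: sum_distrib_left)
    also have "\<dots> \<le> ?V * (2 * energy f f)"
      unfolding w_infsum[symmetric] using U w_sum w_nonneg vol_pos[of \<rho>] inradius_pos
      by (intro mult_left_mono finite_sum_le_infsum) auto
    finally show ?thesis
      using inradius_pos by (simp add: mult.assoc)
  qed
  then show ?thesis
    unfolding ip_def using f by (intro infsum_le_finite_sums) (auto simp: in_l2_iff)
qed

end

section \<open>Observability\<close>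

lemma borel_measurable_infsum:
  fixes g :: "'b \<Rightarrow> 'a::countable \<Rightarrow> real"
  assumes meas: "\<And>x. (\<lambda>t. g t x) \<in> borel_measurable N"
    and sum: "\<And>t. g t summable_on A"
  shows "(\<lambda>t. \<Sum>\<^sub>\<infinity>x\<in>A. g t x) \<in> borel_measurable N"
proof -
  \<comment> \<open>Enumeration by \<open>to_nat\<close> exhausts \<open>A\<close> by finite sets,
    so the unordered sum is a sequential limit of measurable functions.\<close>
  let ?A = "\<lambda>n. {x \<in> A. to_nat x < n}"
  have fin: "finite (?A n)" for n
    by (rule finite_subset[OF _ finite_vimageI[OF finite_lessThan inj_to_nat]]) auto
  have "filterlim ?A (finite_subsets_at_top A) sequentially"
    unfolding filterlim_finite_subsets_at_top
  proof (intro allI impI)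
    fix X assume X: "finite X \<and> X \<subseteq> A"
    have "\<forall>\<^sub>F n in sequentially. \<forall>x\<in>X. to_nat x < n"
      using X by (intro eventually_ball_finite ballI eventually_gt_at_top) auto
    then show "\<forall>\<^sub>F n in sequentially. finite (?A n) \<and> X \<subseteq> ?A n \<and> ?A n \<subseteq> A"
      by eventually_elim (use X fin in auto)
  qed
  then have "(\<lambda>n. \<Sum>x\<in>?A n. g t x) \<longlonglongrightarrow> (\<Sum>\<^sub>\<infinity>x\<in>A. g t x)" for t
    by (rule filterlim_compose[OF infsum_tendsto[OF sum]])
  moreover have "(\<lambda>t. \<Sum>x\<in>?A n. g t x) \<in> borel_measurable N" for n
    by (intro borel_measurable_sum meas)
  ultimately show ?thesis
    by (rule borel_measurable_LIMSEQ_real)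
qed

text \<open>Monotonicity against the constant \<open>y\<close>, whose norm is the left-hand side.
  The upper bound \<open>B\<close> keeps the norm finite: an infinite \<open>esssup\<close> or a
  non-integrable power would be read as \<open>0\<close>.\<close>

lemma Lr_norm_ge:
  fixes g :: "real \<Rightarrow> real"
  assumes ac: "a < c" and r: "r \<ge> 1" and g: "g \<in> borel_measurable borel"
    and y: "y \<ge> 0" "\<And>t. a < t \<Longrightarrow> t < c \<Longrightarrow> y \<le> g t"
    and B: "\<And>t. a < t \<Longrightarrow> t < c \<Longrightarrow> g t \<le> B"
  shows "y * (c - a) powr (if r = \<infinity> then 0 else 1 / real_of_ereal r) \<le> Lr_norm r a c g"
proof (cases "r = \<infinity>")
  case True
  let ?M = "restrict_space lborel {a<..<c}" and ?f = "\<lambda>t. ereal \<bar>g t\<bar>"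
  have f: "?f \<in> borel_measurable ?M"
    using g by (intro measurable_restrict_space1) simp
  have space: "space ?M = {a<..<c}"
    by (simp add: space_restrict_space)
  \<comment> \<open>Positive measure makes a constant its own essential supremum.\<close>
  have "emeasure ?M (space ?M) \<noteq> 0"
    using ac by (simp add: space emeasure_restrict_space)
  then have const: "esssup ?M (\<lambda>_. ereal y) = ereal y"
    by (rule esssup_const)
  have "esssup ?M (\<lambda>_. ereal y) \<le> esssup ?M ?f"
    using y
    by (intro esssup_AE_mono AE_I2) (auto simp: space intro: order_trans[OF _ abs_ge_self])
  moreover have "esssup ?M ?f \<le> ereal B"
    using y B by (intro esssup_I f AE_I2) (fastforce simp: space)
  ultimately have "y \<le> real_of_ereal (esssup ?M ?f)"
    unfolding const by (cases "esssup ?M ?f") auto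
  with True ac show ?thesis
    by (simp add: Lr_norm_def)
next
  case False
  define q where "q = real_of_ereal r"
  have q: "q \<ge> 1"
    using r False by (cases r) (auto simp: q_def)
  let ?f = "\<lambda>t. \<bar>g t\<bar> powr q"
  have "y powr q * (c - a) = set_lebesgue_integral lborel {a<..<c} (\<lambda>_. y powr q)"
    using ac by (subst set_integral_const) auto
  also have "\<dots> \<le> set_lebesgue_integral lborel {a<..<c} ?f"
  proof (rule set_integral_mono)
    show "set_integrable lborel {a<..<c} (\<lambda>_. y powr q)"
      unfolding set_integrable_def by (rule integrableI_bounded_set_indicator[where B = "y powr q"]) (use ac in auto)
    show "set_integrable lborel {a<..<c} ?f"
      unfolding set_integrable_def
    proof (rule integrableI_bounded_set_indicator[where B = "B powr q"])
      show "?f \<in> borel_measurable lborel"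
        using g by measurable
      show "AE t in lborel. t \<in> {a<..<c} \<longrightarrow> norm (?f t) \<le> B powr q"
        using q y B by (intro AE_I2) (fastforce intro!: powr_mono2)
    qed (use ac in auto)
    show "y powr q \<le> ?f t" if "t \<in> {a<..<c}" for t
      using that q y by (intro powr_mono2) (auto intro: order_trans[OF _ abs_ge_self])
  qed
  finally have "(y powr q * (c - a)) powr (1 / q) \<le> set_lebesgue_integral lborel {a<..<c} ?f powr (1 / q)"
    using q ac by (intro powr_mono2) auto
  moreover have "(y powr q * (c - a)) powr (1 / q) = y * (c - a) powr (1 / q)"
    using q y ac by (simp add: powr_mult powr_powr)
  ultimately show ?thesis
    using False by (simp add: Lr_norm_def q_def)
qed

section \<open>Operator norm, energy and observed norms\<close>

context bounded_graph
begin

abbreviation N :: real where "N \<equiv> opnorm_H1 b m"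

lemma l2norm_Lap_add_le: "in_l2 m f \<Longrightarrow> l2norm m (\<lambda>x. Lap b m f x + f x) \<le> (2 * M + 1) * l2norm m f"
  using l2norm_add_le[OF Lap_in_l2, of f f] l2norm_Lap_le[of f] by (simp add: algebra_simps)

text \<open>Normalise \<open>f\<close> and compare with the supremum, which is finite since
  \<open>2 * M + 1\<close> bounds the set. Norm zero, where normalisation fails, is covered by the
  cruder bound.\<close>

lemma l2norm_Lap_add_le_opnorm:
  assumes f: "in_l2 m f"
  shows "l2norm m (\<lambda>x. Lap b m f x + f x) \<le> N * l2norm m f"
proof (cases "l2norm m f = 0")
  case True
  then show ?thesis
    using l2norm_Lap_add_le[OF f] by simp
next
  case False
  define c where "c = l2norm m f"
  have c: "c > 0"
    using False l2norm_nonneg[of f] by (simp add: c_def)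
  let ?g = "\<lambda>x. (1 / c) *\<^sub>R f x"
  have g: "in_l2 m ?g" "l2norm m ?g \<le> 1"
    using c f by (auto simp: l2norm_scaleR c_def intro: in_l2_scaleR)
  have "l2norm m (\<lambda>x. Lap b m ?g x + ?g x) \<le> N"
    unfolding opnorm_H1_def
  proof (rule cSup_upper)
    show "bdd_above {l2norm m (\<lambda>x. Lap b m f x + f x) |f. in_l2 m f \<and> l2norm m f \<le> 1}"
    proof (rule bdd_aboveI, clarify)
      fix f assume f: "in_l2 m f" and "l2norm m f \<le> 1"
      then have "(2 * M + 1) * l2norm m f \<le> (2 * M + 1) * 1"
        using M_nonneg by (intro mult_left_mono) auto
      with l2norm_Lap_add_le[OF f] show "l2norm m (\<lambda>x. Lap b m f x + f x) \<le> 2 * M + 1"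
        by simp
    qed
  qed (use g in blast)
  moreover have "(\<lambda>x. Lap b m ?g x + ?g x) = (\<lambda>x. (1 / c) *\<^sub>R (Lap b m f x + f x))"
    unfolding Lap_scaleR[OF f] by (simp only: scaleR_add_right)
  ultimately have "(1 / c) * l2norm m (\<lambda>x. Lap b m f x + f x) \<le> N"
    using c by (simp only: l2norm_scaleR abs_of_pos zero_less_divide_1_iff)
  then show ?thesis
    using c by (simp add: c_def[symmetric] field_simps)
qed

text \<open>By Green's formula the left-hand side is \<langle>(H + 1) f, f\<rangle>, to which
  Cauchy-Schwarz applies.\<close>

lemma energy_add_ip_le:
  assumes f: "in_l2 m f"
  shows "energy f f + ip f f \<le> N * ip f f"
proof -
  have "energy f f + ip f f = ip (\<lambda>x. Lap b m f x + f x) f"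
    using f by (simp add: ip_add_left ip_Lap_left Lap_in_l2)
  also have "\<dots> \<le> l2norm m (\<lambda>x. Lap b m f x + f x) * l2norm m f"
    using f by (intro ip_le in_l2_add Lap_in_l2)
  also have "\<dots> \<le> (N * l2norm m f) * l2norm m f"
    using f by (intro mult_right_mono l2norm_Lap_add_le_opnorm l2norm_nonneg)
  also have "\<dots> = N * ip f f"
    by (simp flip: l2norm_power2 add: power2_eq_square)
  finally show ?thesis .
qed

text \<open>At each pair, up to the weight \<open>b x y\<close>, the right side exceeds the left by
  half the square of \<open>u + 2 *\<^sub>R v\<close>. The coefficient \<open>3 / 2\<close> is below
  \<open>2\<close> so that the energy of \<open>f\<close> can later be absorbed.\<close>

lemma energy_diff_le:
  assumes f: "in_l2 m f" and g: "in_l2 m g"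
  shows "energy (\<lambda>x. f x - g x) (\<lambda>x. f x - g x) \<le> 3 / 2 * energy f f + 3 * energy g g"
proof -
  let ?e = "\<lambda>f. \<lambda>(x, y). b x y * ((f x - f y) \<bullet> (f x - f y))"
  have "2 * energy (\<lambda>x. f x - g x) (\<lambda>x. f x - g x) = infsum (?e (\<lambda>x. f x - g x)) UNIV"
    by (simp add: energy_def)
  also have "\<dots> \<le> (\<Sum>\<^sub>\<infinity>p. 3 / 2 * ?e f p + 3 * ?e g p)"
  proof (rule infsum_mono)
    show "?e (\<lambda>x. f x - g x) summable_on UNIV"
      using f g by (intro energy_summable in_l2_diff)
    show "(\<lambda>p. 3 / 2 * ?e f p + 3 * ?e g p) summable_on UNIV"
      using f g by (intro summable_on_add summable_on_cmult_right energy_summable)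
    fix p :: "'a \<times> 'a"
    obtain x y where p: "p = (x, y)"
      by (cases p)
    define u v where "u = f x - f y" and "v = g x - g y"
    have *: "(u - v) \<bullet> (u - v) \<le> 3 / 2 * (u \<bullet> u) + 3 * (v \<bullet> v)"
      using inner_ge_zero[of "u + 2 *\<^sub>R v"] by (simp add: inner_add inner_diff inner_commute[of v u])
    have "f x - g x - (f y - g y) = u - v"
      by (simp add: u_def v_def)
    then show "?e (\<lambda>x. f x - g x) p \<le> 3 / 2 * ?e f p + 3 * ?e g p"
      using mult_left_mono[OF * b_nonneg[of x y]]
      unfolding p prod.case u_def[symmetric] v_def[symmetric]
      by (simp add: distrib_left mult.left_commute)
  qed
  also have "\<dots> = 3 / 2 * infsum (?e f) UNIV + 3 * infsum (?e g) UNIV"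
    using f g by (simp only: infsum_add infsum_cmult_right' summable_on_cmult_right energy_summable)
  finally show ?thesis
    by (simp add: energy_def)
qed

lemma l2norm_on_eq: "l2norm_on m A f = l2norm m (\<lambda>x. if x \<in> A then f x else 0)"
  unfolding l2norm_def l2norm_on_def by (rule arg_cong[of _ _ sqrt], rule infsum_cong_neutral) auto

lemma l2norm_on_le:
  assumes "in_l2 m f"
  shows "l2norm_on m A f \<le> l2norm m f"
  unfolding l2norm_def l2norm_on_def using assms[unfolded in_l2_def]
  by (intro real_sqrt_le_mono infsum_mono_neutral) (auto simp: m_nonneg intro: summable_on_subset)

lemma l2norm_on_heat_measurable:
  assumes f: "in_l2 m f"
  shows "(\<lambda>t. l2norm_on m A (heat b m t f)) \<in> borel_measurable borel"
  unfolding l2norm_on_def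
proof (rule borel_measurable_continuous_on[OF continuous_on_real_sqrt[OF continuous_on_id]], rule borel_measurable_infsum)
  show "(\<lambda>t. (cmod (heat b m t f x))\<^sup>2 * m x) \<in> borel_measurable borel" for x
    by (intro borel_measurable_continuous_onI continuous_intros heat_pointwise_continuous f)
  show "(\<lambda>x. (cmod (heat b m t f x))\<^sup>2 * m x) summable_on A" for t
    using heat_in_l2[OF f, of t] unfolding in_l2_def by (rule summable_on_subset) auto
qed

end

section \<open>Low energy and the dichotomy for the heat flow\<close>

context observation_graph
begin

text \<open>The constant of the Poincare inequality; in terms of it
  \<open>lam = 1 / (2 * \<nu>)\<close> and \<open>\<kappa> = 8 * N\<^sup>2 * \<nu>\<close>.\<close>

definition \<nu> :: real where "\<nu> = \<rho> * vol (dL b) m \<rho>"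

lemma \<nu>_pos: "\<nu> > 0"
  using inradius_pos vol_pos[of \<rho>] by (simp add: \<nu>_def)

text \<open>Test the Poincare inequality with the indicator of a vertex outside \<open>D\<close>.
  The outcome yields \<open>N \<ge> 1\<close> and \<open>N * \<nu> \<ge> 1\<close>, which let the
  constants be collected into \<open>8 * N\<^sup>2 * \<nu>\<close>.\<close>

lemma opnorm_ge: "1 / \<nu> + 1 \<le> N"
proof -
  obtain z where z: "z \<notin> D"
    using D_proper by auto
  define f where "f = (\<lambda>x. if x = z then 1 else 0 :: complex)"
  have f: "in_l2 m f"
    unfolding in_l2_def
    by (rule finite_nonzero_values_imp_summable_on) (rule finite_subset[of _ "{z}"], auto simp: f_def)
  have "m z * (f z \<bullet> f z) \<le> ip f f"
    using sum_le_ip[OF f, of "{z}"] by simp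
  then have pos: "ip f f > 0"
    using m_pos[of z] by (simp add: f_def)
  have "ip f f \<le> \<nu> * energy f f"
    unfolding \<nu>_def using z by (intro Poincare_inequality f) (auto simp: f_def)
  then have "(1 / \<nu>) * ip f f \<le> energy f f"
    using \<nu>_pos by (simp add: field_simps)
  then have "(1 / \<nu> + 1) * ip f f \<le> N * ip f f"
    using energy_add_ip_le[OF f] by (simp add: algebra_simps)
  then show ?thesis
    using pos by simp
qed

text \<open>
  The Poincare inequality applied to \<open>f - f|\<^sub>D\<close> shows that low energy forces a fixed share of the
  norm onto \<open>D\<close>.
\<close>

lemma uncertainty_of_energy_le:
  assumes f: "in_l2 m f" and le: "energy f f \<le> 1 / (2 * \<nu>) * ip f f"
  shows "l2norm m f \<le> 8 * N\<^sup>2 * \<nu> * l2norm_on m D f"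
proof -
  define g where "g = (\<lambda>x. if x \<in> D then f x else 0)"
  define u where "u = (\<lambda>x. f x - g x)"
  define F where "F = ip f f"
  define G where "G = ip g g"
  define U where "U = ip u u"
  have g: "in_l2 m g"
    unfolding g_def using f by (rule in_l2_restrict)
  have u: "in_l2 m u"
    unfolding u_def using f g by (rule in_l2_diff)
  \<comment> \<open>\<open>g\<close> equals \<open>f\<close> on \<open>D\<close> and vanishes
    elsewhere, so \<open>f - g\<close> is orthogonal to \<open>g\<close> and the squared norms
    subtract.\<close>
  have "ip f g = G"
    unfolding ip_def G_def by (rule infsum_cong) (simp add: g_def)
  then have U: "U = F - G"
    unfolding U_def u_def F_def G_def using f g
    by (simp add: ip_diff_left ip_diff_right in_l2_diff ip_commute[of g f])
  have N: "N \<ge> 1"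
    using opnorm_ge divide_pos_pos[OF zero_less_one \<nu>_pos] by linarith
  have "N * \<nu> \<ge> 1"
    using opnorm_ge \<nu>_pos by (simp add: field_simps)
  have G_nonneg: "G \<ge> 0"
    unfolding G_def by (rule ip_self_nonneg)
  have "energy g g \<le> N * G"
    using energy_add_ip_le[OF g] G_nonneg by (simp add: G_def)
  \<comment> \<open>Multiplied by \<open>\<nu>\<close>, the coefficient of \<open>F\<close> becomes
    \<open>3 / 4\<close>, so a quarter of \<open>F\<close> survives on the left.\<close>
  then have "energy u u \<le> 3 / 2 * (1 / (2 * \<nu>) * F) + 3 * (N * G)"
    using energy_diff_le[OF f g] le unfolding u_def F_def by linarith
  from mult_left_mono[OF this, of \<nu>]
  have "\<nu> * energy u u \<le> \<nu> * (3 / 2 * (1 / (2 * \<nu>) * F) + 3 * (N * G))"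
    using \<nu>_pos by simp
  also have "\<dots> = 3 / 4 * F + 3 * (N * \<nu>) * G"
    using \<nu>_pos by (simp add: distrib_left)
  finally have "\<nu> * energy u u \<le> 3 / 4 * F + 3 * (N * \<nu>) * G" .
  moreover have "U \<le> \<nu> * energy u u"
    unfolding U_def \<nu>_def by (intro Poincare_inequality u) (simp add: u_def g_def)
  ultimately have "F \<le> (4 + 12 * (N * \<nu>)) * G"
    unfolding U by (simp add: algebra_simps)
  also have "\<dots> \<le> (8 * N\<^sup>2 * \<nu>)\<^sup>2 * G"
  proof (rule mult_right_mono[OF _ G_nonneg])
    define c where "c = N * \<nu>"
    \<comment> \<open>Uses \<open>c \<ge> 1\<close> and hence \<open>c\<^sup>2 \<ge> c\<close>;
      afterwards \<open>N \<ge> 1\<close> allows the passage from \<open>N\<close> to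
      \<open>N\<^sup>2\<close>.\<close>
    have "4 + 12 * c \<le> 64 * c\<^sup>2"
      using mult_left_mono[of 1 c c] \<open>N * \<nu> \<ge> 1\<close> unfolding c_def[symmetric] power2_eq_square
      by linarith
    also have "\<dots> = (8 * (1 * N) * \<nu>)\<^sup>2"
      by (simp add: c_def power_mult_distrib)
    also have "\<dots> \<le> (8 * (N * N) * \<nu>)\<^sup>2"
      using N \<nu>_pos by (intro power_mono mult_right_mono mult_left_mono) auto
    finally show "4 + 12 * (N * \<nu>) \<le> (8 * N\<^sup>2 * \<nu>)\<^sup>2"
      by (simp add: c_def power2_eq_square)
  qed
  also have "\<dots> = (8 * N\<^sup>2 * \<nu> * l2norm_on m D f)\<^sup>2"
    unfolding l2norm_on_eq G_def g_def[symmetric] power_mult_distrib[of _ "l2norm m g"] l2norm_power2 ..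
  finally have "(l2norm m f)\<^sup>2 \<le> (8 * N\<^sup>2 * \<nu> * l2norm_on m D f)\<^sup>2"
    by (simp add: F_def l2norm_power2)
  moreover have "0 \<le> 8 * N\<^sup>2 * \<nu> * l2norm_on m D f"
    using \<nu>_pos by (simp add: l2norm_on_eq l2norm_nonneg)
  ultimately show ?thesis
    by (rule power2_le_imp_le)
qed

text \<open>At or above the energy threshold the decay estimate gives the second summand, below it
  the low-energy estimate gives the first; the other summand is nonnegative.\<close>

lemma heat_dichotomy:
  assumes f: "in_l2 m f" and t: "t \<ge> 0"
  shows "l2norm m (heat b m t f)
    \<le> 8 * N\<^sup>2 * \<nu> * l2norm_on m D (heat b m t f) + exp (- (1 / (2 * \<nu>)) * t) * l2norm m f"
proof (cases "energy (heat b m t f) (heat b m t f) \<ge> 1 / (2 * \<nu>) * ip (heat b m t f) (heat b m t f)")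
  case True
  moreover have "0 \<le> 8 * N\<^sup>2 * \<nu> * l2norm_on m D (heat b m t f)"
    using \<nu>_pos by (simp add: l2norm_on_eq l2norm_nonneg)
  ultimately show ?thesis
    using heat_decay_of_energy_ge[OF f t] by (meson add_increasing)
next
  case False
  then show ?thesis
    using uncertainty_of_energy_le[OF heat_in_l2[OF f], of t]
      mult_nonneg_nonneg[OF exp_ge_zero l2norm_nonneg, of "- (1 / (2 * \<nu>)) * t" f] by linarith
qed

end

theorem mainTheorem2:
  fixes b :: "'a::countable \<Rightarrow> 'a \<Rightarrow> real" and m :: "'a \<Rightarrow> real"
    and D :: "'a set" and T \<delta> :: real and r :: ereal and \<phi>0 :: "'a \<Rightarrow> complex"
  assumes wg: "weighted_graph b m"
    and C: "connected_graph b" and B: "bounded_degree b m" and M: "bounded_measure m"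
    and D_proper: "D \<subset> UNIV" and D_dense: "rel_dense (dL b) D"
    and T_pos: "T > 0" and \<delta>_ge: "0 \<le> \<delta>" and \<delta>_lt: "\<delta> < 1" and r_ge: "r \<ge> 1"
    and \<phi>0_l2: "in_l2 m \<phi>0"
  shows
    "let \<Omega> = UNIV - D;
         \<rho> = inradius (dL b) \<Omega>;
         lam = 1 / (2 * (\<rho> * vol (dL b) m \<rho>));
         \<kappa> = 8 * (opnorm_H1 b m)\<^sup>2 * \<rho> * vol (dL b) m \<rho>;
         K = \<kappa> / ((1 - \<delta>) * T) powr (if r = \<infinity> then 0 else 1 / real_of_ereal r);
         \<alpha> = (\<kappa> + 1) * exp (- \<delta> * lam * T)
     in l2norm m (heat b m T \<phi>0)
          \<le> K * Lr_norm r (\<delta> * T) T (\<lambda>t. l2norm_on m D (heat b m t \<phi>0)) + \<alpha> * l2norm m \<phi>0"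
proof -
  interpret observation_graph b m D
    by unfold_locales (fact wg B C M D_proper D_dense)+
  define lam where "lam = 1 / (2 * \<nu>)"
  define \<kappa> where "\<kappa> = 8 * N\<^sup>2 * \<rho> * vol (dL b) m \<rho>"
  define p where "p = (if r = \<infinity> then 0 else 1 / real_of_ereal r)"
  define \<alpha> where "\<alpha> = (\<kappa> + 1) * exp (- \<delta> * lam * T)"
  define h where "h = (\<lambda>t. l2norm_on m D (heat b m t \<phi>0))"
  define w where "w = ((1 - \<delta>) * T) powr p"
  let ?n = "l2norm m \<phi>0" and ?a = "\<delta> * T"
  have \<kappa>_eq: "\<kappa> = 8 * N\<^sup>2 * \<nu>"
    by (simp add: \<kappa>_def \<nu>_def)
  have lam: "lam > 0"
    using \<nu>_pos by (simp add: lam_def)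
  have \<kappa>: "\<kappa> > 0"
  proof -
    have "N \<noteq> 0"
      using opnorm_ge divide_pos_pos[OF zero_less_one \<nu>_pos] by linarith
    then show ?thesis
      unfolding \<kappa>_eq using \<nu>_pos by simp
  qed
  have w: "w > 0"
    using T_pos \<delta>_lt by (simp add: w_def)
  \<comment> \<open>The constant lower bound for the observed norm on
    \<open>(\<delta> * T, T)\<close>; the \<open>max\<close> supplies the sign that
    \<open>Lr_norm_ge\<close> asks for.\<close>
  define y where "y = max 0 ((l2norm m (heat b m T \<phi>0) - \<alpha> * ?n) / \<kappa>)"
  have h_nonneg: "h t \<ge> 0" for t
    by (simp add: h_def l2norm_on_eq l2norm_nonneg)
  have y_le: "y \<le> h t" if t: "?a < t" "t < T" for t
  proof -
    have "t \<ge> 0"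
      using t mult_nonneg_nonneg[OF \<delta>_ge less_imp_le[OF T_pos]] by linarith
    have "l2norm m (heat b m T \<phi>0) \<le> l2norm m (heat b m t \<phi>0)"
      using t by (intro l2norm_heat_antimono \<phi>0_l2) simp
    also have "\<dots> \<le> \<kappa> * h t + exp (- lam * t) * ?n"
      using heat_dichotomy[OF \<phi>0_l2 \<open>t \<ge> 0\<close>] by (simp only: \<kappa>_eq h_def lam_def)
    also have "exp (- lam * t) * ?n \<le> \<alpha> * ?n"
    proof (rule mult_right_mono[OF _ l2norm_nonneg])
      \<comment> \<open>\<open>t > \<delta> * T\<close> and \<open>lam > 0\<close> compare the
        exponents; then \<open>\<kappa> + 1 \<ge> 1\<close> gives \<open>\<alpha>\<close>.\<close>
      have "exp (- lam * t) \<le> 1 * exp (- \<delta> * lam * T)"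
        using mult_left_mono[of ?a t lam] t lam by (simp add: mult_ac)
      also have "\<dots> \<le> \<alpha>"
        unfolding \<alpha>_def using \<kappa> by (intro mult_right_mono) auto
      finally show "exp (- lam * t) \<le> \<alpha>" .
    qed
    finally show ?thesis
      using \<kappa> h_nonneg[of t] by (simp add: y_def field_simps)
  qed
  have "y * (T - ?a) powr p \<le> Lr_norm r ?a T h"
    unfolding p_def
  proof (rule Lr_norm_ge)
    show "?a < T"
      using T_pos \<delta>_lt by simp
    show "h \<in> borel_measurable borel"
      unfolding h_def using \<phi>0_l2 by (rule l2norm_on_heat_measurable)
    \<comment> \<open>Contractivity bounds the observed norm by the initial norm, which keeps the Lr
      norm finite.\<close>
    show "h t \<le> ?n" if t: "?a < t" "t < T" for t
    proof -
      have "0 \<le> t"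
        using t mult_nonneg_nonneg[OF \<delta>_ge less_imp_le[OF T_pos]] by linarith
      have "h t \<le> l2norm m (heat b m t \<phi>0)"
        unfolding h_def by (intro l2norm_on_le heat_in_l2 \<phi>0_l2)
      also have "\<dots> \<le> ?n"
        using l2norm_heat_antimono[OF \<phi>0_l2 \<open>0 \<le> t\<close>] by (simp add: heat_zero)
      finally show ?thesis .
    qed
  qed (use y_le r_ge in \<open>auto simp: y_def\<close>)
  then have "y * w \<le> Lr_norm r ?a T h"
    by (simp add: w_def algebra_simps)
  then have "\<kappa> * y \<le> \<kappa> / w * Lr_norm r ?a T h"
    using \<kappa> w by (simp add: field_simps)
  \<comment> \<open>Holds in both branches of the \<open>max\<close>: a negative difference lies
    below \<open>0\<close>.\<close>
  moreover have "l2norm m (heat b m T \<phi>0) - \<alpha> * ?n \<le> \<kappa> * y"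
    using \<kappa> by (simp add: y_def max_def field_simps)
  ultimately show ?thesis
    unfolding Let_def h_def \<alpha>_def w_def p_def lam_def \<kappa>_def \<nu>_def by linarith
qed

end
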